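(* Let $d\ge 1$. There exist constants $C(s,d)>0$ (depending only on $s\in\mathbb{N}$ and $d$) such that the following holds. Let $P\subset\mathbb{R}^d$ be a bounded convex polyhedron such that $P\subset[0,n_1]\times\dots\times[0,n_d]$, where $n_1,\dots,n_d$ are real numbers with $n_j\ge 1$ for $j=1,\dots,d$, and let $s$ be the size of a triangulation of $P$. Then $$\mathcal{L}(P)\le C(s,d)\prod_{j=1}^d\log(n_j+1).$$ Moreover, as $\min_{j=1,\dots,d}n_j\to\infty$ the constant may be taken to be at most $C(d)s$; that is, there are a constant $C(d)>0$ depending only on $d$ and, for each $s\in\mathbb{N}$, a number $N_0(s,d)$ such that, for every such $P$ and $n_1,\dots,n_d$ with $\min_{j}n_j\ge N_0(s,d)$, $$\mathcal{L}(P)\le C(d)\,s\prod_{j=1}^d\log(n_j+1).$$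
   Context: For a bounded set $W\subset\mathbb{R}^d$ the Lebesgue constant is $$\mathcal{L}(W)=\frac{1}{(2\pi)^d}\int_{\mathbb{T}^d}\bigg|\sum_{\bm{k}\in W\cap\mathbb{Z}^d}e^{i(\bm{k},\bm{x})}\bigg|\,d\bm{x},\qquad \mathbb{T}^d\simeq(-\pi,\pi]^d,$$ where $(\bm{k},\bm{x})=k_1x_1+\dots+k_dx_d$ and an empty sum is $0$. A triangulation of a convex polyhedron $P$ is a representation of $P$ as a finite union of tetrahedra (simplices) $T_1,\dots,T_s$ such that for $i\ne j$ the intersection $T_i\cap T_j$ is either empty or a face of both; its size is the number $s$ of simplices. *)

theory Defs
  imports "HOL-Analysis.Analysis"
begin

definition lebesgue_constant :: "(real ^ 'd) set \<Rightarrow> real" where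
  "lebesgue_constant W =
     1 / (2 * pi) ^ CARD('d) *
     (LINT x : {x. \<forall>j. - pi < x $ j \<and> x $ j \<le> pi} | lborel.
        cmod (\<Sum>k \<in> {k \<in> W. \<forall>j. k $ j \<in> \<int>}. exp (\<i> * complex_of_real (k \<bullet> x))))"

text \<open>
  The library's \<^const>\<open>triangulation\<close> asks for finitely many simplices (of any dimension) any two
  of which meet in a common face; the empty set counts as a face there, so disjoint simplices are
  covered. It also admits the empty set as a simplex of dimension $-1$, which we exclude.
\<close>
definition triangulates :: "(real ^ 'd) set set \<Rightarrow> (real ^ 'd) set \<Rightarrow> bool" where
  "triangulates \<T> P \<longleftrightarrow> triangulation \<T> \<and> {} \<notin> \<T> \<and> \<Union>\<T> = P"

end

theory Submission imports Defs begin

text \<open>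
  Since the relative interiors of the faces of a triangulation partition $P$, it is enough to bound
  the Lebesgue constant of a set of integer points that is cut out of the box
  $[0,n_1]\times\dots\times[0,n_d]$ by a bounded number $m$ of half-spaces, by
  $C(d,m) \prod_j \log(n_j+1)$. As a simplex has at most $2^{d+1}$ faces, each described by
  barycentric coordinates, the constant for $P$ is then linear in the number of simplices
  (\<open>torus_norm_union_simplices\<close>).

  The bound for such a cell (\<open>torus_norm_cell\<close>) is proved by induction on the dimension. Let $n_j$
  be the largest side and sum over the coordinate $k_j$ first. For fixed remaining coordinates $k'$,
  the values of $k_j$ form an interval from $\lceil \ell(k') \rceil$ to $\lfloor u(k') \rfloor$, and
  after cutting the cell into boundedly many cells the functions $\ell$ and $u$ are affine
  (\<open>cell_fibre_decomposition\<close>). With $t = x_j$, the geometric series leaves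
  \[ \frac{1}{|e^{it}-1|} \Big\| \sum_{k'} e^{i (k',x')} e^{i \lfloor u(k') \rfloor t} \Big\|_1 \]
  and the same with $\lceil \ell \rceil$. Without the floor the exponential would be a translation
  in $x'$ and the norm that of the lower-dimensional cell; integrating $1/|t|$ over
  $1/n_j \le |t| \le \pi$ would give the factor $\log(n_j+1)$.

  The floor is the real difficulty. The correction $e^{-i\{u\}t}$ is a periodic function of $u$ with
  a jump of size about $|t|$, so its Fourier coefficients are of size $|t|/|m|$ and would have to be
  summed over infinitely many $m$. The sum becomes finite because $u$ may be
  replaced: the coefficients of $u$ only have to satisfy finitely many integral inequalities
  $f(k') \le u(k') < f(k') + 1$, and Fourier-Motzkin elimination shows that a solution exists whose
  denominator $q$ is polynomial in the largest side (\<open>fourier_motzkin_gap\<close>,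
  \<open>floor_affine_eq_div\<close>). For rational $u$ the correction is a combination of $q$ characters with
  coefficient sum $1 + O(|t| \log q)$ (\<open>cis_div_expansion\<close>), and $\log q = O(\log(n_j+1))$ because
  $n_j$ is largest. The factor $|t|$ cancels the pole at $t = 0$, so the floor contributes another
  $O(\log(n_j+1))$ to the integral and nothing worse.
\<close>

section \<open>Integral systems of inequalities and rational approximation\<close>

lemma finite_separation:
  fixes X Y :: "real set"
  assumes "finite X" "finite Y" "\<And>x y. x \<in> X \<Longrightarrow> y \<in> Y \<Longrightarrow> x \<le> y"
  shows "\<exists>z. (\<forall>x\<in>X. x \<le> z) \<and> (\<forall>y\<in>Y. z \<le> y)"
proof (cases "X = {}")
  case True
  then show ?thesis using assms(2) by (cases "Y = {}") (auto intro: exI[of _ "Min Y"])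
next
  case False
  then show ?thesis using assms by (intro exI[of _ "Max X"]) auto
qed

text \<open>
  If integer constraints with coefficients at most $A$ can be satisfied with \<^emph>\<open>some\<close> slack
  $\delta > 0$, they can be satisfied with a slack that is a power of $1/(2A)$, whatever the
  right-hand sides are. The unknowns are eliminated one after the other by Fourier-Motzkin: pairing
  an upper with a lower bound for an unknown gives a constraint that is again integral, with
  coefficients at most $2A^2$, that is, $2A$ is squared in each round. Once only the slack is left,
  a constraint reads $e \delta \le c$ with integers $e \ge 0$ and $c$; if $e > 0$, then $c > 0$
  forces $c \ge 1$, and $\delta = 1/e$ is admissible.

  A constraint is a triple: the row of coefficients, the coefficient of the slack, and the
  right-hand side.
\<close>

lemma fourier_motzkin_gap:
  fixes A :: int and S :: "(('j \<Rightarrow> int) \<times> int \<times> int) set"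
    and \<delta> :: real and y :: "'j \<Rightarrow> real"
  assumes "finite J" "finite S" "1 \<le> A"
    and "\<And>a e c. (a, e, c) \<in> S \<Longrightarrow> 0 \<le> e \<and> e \<le> A \<and> (\<forall>j\<in>J. \<bar>a j\<bar> \<le> A)"
    and "0 < \<delta>"
    and "\<And>a e c. (a, e, c) \<in> S \<Longrightarrow> (\<Sum>j\<in>J. of_int (a j) * y j) + of_int e * \<delta> \<le> of_int c"
  shows "\<exists>y::'j \<Rightarrow> real. \<forall>(a, e, c) \<in> S.
      (\<Sum>j\<in>J. of_int (a j) * y j) + of_int e / (2 * of_int A) ^ (2 ^ card J) \<le> of_int c"
  using assms
proof (induction J arbitrary: S A rule: finite_induct)
  case empty
  have "of_int e / (2 * real_of_int A) \<le> of_int c" if S: "(a, e, c) \<in> S" for a e c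
  proof -
    have e: "0 \<le> e" "e \<le> A" using empty.prems(3)[OF S] by auto
    have *: "of_int e * \<delta> \<le> of_int c" using empty.prems(5)[OF S] by simp
    show ?thesis
    proof (cases "e = 0")
      case True
      then show ?thesis using * by simp
    next
      case False
      then have "0 < of_int e * \<delta>" using e \<open>0 < \<delta>\<close> by simp
      with * have "1 \<le> c" by linarith
      have "of_int e / (2 * real_of_int A) \<le> 1" using e \<open>1 \<le> A\<close> by (simp add: divide_simps)
      also have "\<dots> \<le> of_int c" using \<open>1 \<le> c\<close> by simp
      finally show ?thesis .
    qed
  qed
  then show ?case by auto
next
  case (insert i J)
  define Z where "Z = {s \<in> S. fst s i = 0}"
  define U where "U = {s \<in> S. 0 < fst s i}"
  define L where "L = {s \<in> S. fst s i < 0}"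
  define comb :: "(('j \<Rightarrow> int) \<times> int \<times> int) \<times> (('j \<Rightarrow> int) \<times> int \<times> int) \<Rightarrow> ('j \<Rightarrow> int) \<times> int \<times> int"
    where "comb = (\<lambda>((a, e, c), (a', e', c')).
      (\<lambda>j. (- a' i) * a j + a i * a' j, (- a' i) * e + a i * e', (- a' i) * c + a i * c'))"
  define S' where "S' = Z \<union> comb ` (U \<times> L)"
  have finS: "finite S" by fact
  have fin: "finite S'" using finS unfolding S'_def Z_def U_def L_def by auto
  have "A * 1 \<le> A * A" using \<open>1 \<le> A\<close> by (intro mult_left_mono) auto
  then have "A \<le> A * A" by simp
  with \<open>1 \<le> A\<close> have AA: "A \<le> 2 * A ^ 2" "1 \<le> 2 * A ^ 2"
    unfolding power2_eq_square by linarith+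
  have prod_bound: "0 \<le> p * e + q * e' \<and> p * e + q * e' \<le> 2 * A\<^sup>2"
    if "0 \<le> p" "p \<le> A" "0 \<le> q" "q \<le> A" "0 \<le> e" "e \<le> A" "0 \<le> e'" "e' \<le> A" for p q e e'
  proof -
    have "p * e \<le> A * A" "q * e' \<le> A * A" using that by (auto intro!: mult_mono)
    moreover have "0 \<le> p * e" "0 \<le> q * e'" using that by auto
    ultimately show ?thesis by (simp add: power2_eq_square)
  qed
  have abs_bound: "\<bar>p * x + q * x'\<bar> \<le> 2 * A\<^sup>2"
    if "0 \<le> p" "p \<le> A" "0 \<le> q" "q \<le> A" "\<bar>x\<bar> \<le> A" "\<bar>x'\<bar> \<le> A" for p q x x'
  proof -
    have "\<bar>p * x + q * x'\<bar> \<le> p * \<bar>x\<bar> + q * \<bar>x'\<bar>"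
      using that by (metis abs_mult abs_of_nonneg abs_triangle_ineq)
    then show ?thesis using prod_bound[of p q "\<bar>x\<bar>" "\<bar>x'\<bar>"] that by auto
  qed
  have bound: "0 \<le> e \<and> e \<le> 2 * A\<^sup>2 \<and> (\<forall>j\<in>J. \<bar>a j\<bar> \<le> 2 * A\<^sup>2)" if mem: "(a, e, c) \<in> S'" for a e c
  proof -
    consider "(a, e, c) \<in> S" | s t where "s \<in> U" "t \<in> L" "(a, e, c) = comb (s, t)"
      using mem unfolding S'_def Z_def by blast
    then show ?thesis
    proof cases
      case 1
      then show ?thesis using insert.prems(3)[OF 1] AA by force
    next
      case 2
      obtain a1 e1 c1 a2 e2 c2 where st: "s = (a1, e1, c1)" "t = (a2, e2, c2)"
        by (metis prod_cases3)
      have i: "(a1, e1, c1) \<in> S" "(a2, e2, c2) \<in> S" "0 < a1 i" "a2 i < 0"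
        using 2 st unfolding U_def L_def by auto
      note b1 = insert.prems(3)[OF i(1)] and b2 = insert.prems(3)[OF i(2)]
      have "a = (\<lambda>j. (- a2 i) * a1 j + a1 i * a2 j)" "e = (- a2 i) * e1 + a1 i * e2"
        using 2(3) st by (auto simp: comb_def)
      moreover have "0 \<le> - a2 i" "- a2 i \<le> A" "0 \<le> a1 i" "a1 i \<le> A"
        using b1 b2 i(3,4) by auto
      ultimately show ?thesis
        using prod_bound[of "- a2 i" "a1 i" e1 e2] abs_bound[of "- a2 i" "a1 i"] b1 b2 by simp
    qed
  qed
  have feas: "(\<Sum>j\<in>J. of_int (a j) * y j) + of_int e * \<delta> \<le> of_int c" if mem: "(a, e, c) \<in> S'" for a e c
  proof -
    consider "(a, e, c) \<in> Z" | s t where "s \<in> U" "t \<in> L" "(a, e, c) = comb (s, t)"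
      using mem unfolding S'_def by blast
    then show ?thesis
    proof cases
      case 1
      then show ?thesis using insert.prems(5)[of a e c] insert.hyps unfolding Z_def by auto
    next
      case 2
      obtain a1 e1 c1 a2 e2 c2 where st: "s = (a1, e1, c1)" "t = (a2, e2, c2)"
        by (metis prod_cases3)
      have i: "(a1, e1, c1) \<in> S" "(a2, e2, c2) \<in> S" "0 < a1 i" "a2 i < 0"
        using 2 st unfolding U_def L_def by auto
      define p q where "p = real_of_int (- a2 i)" and "q = real_of_int (a1 i)"
      have pq: "0 < p" "0 < q" using i by (auto simp: p_def q_def)
      define S1 S2 where "S1 = (\<Sum>j\<in>J. of_int (a1 j) * y j)" and "S2 = (\<Sum>j\<in>J. of_int (a2 j) * y j)"
      have eqs: "a = (\<lambda>j. (- a2 i) * a1 j + a1 i * a2 j)" "e = (- a2 i) * e1 + a1 i * e2"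
        "c = (- a2 i) * c1 + a1 i * c2"
        using 2(3) st by (auto simp: comb_def)
      have S: "(\<Sum>j\<in>J. of_int (a j) * y j) = p * S1 + q * S2"
        unfolding S1_def S2_def sum_distrib_left sum.distrib[symmetric]
        by (intro sum.cong) (simp_all add: eqs p_def q_def algebra_simps)
      have "p * (of_int (a1 i) * y i + S1 + of_int e1 * \<delta>)
          + q * (of_int (a2 i) * y i + S2 + of_int e2 * \<delta>) \<le> p * of_int c1 + q * of_int c2"
        using insert.prems(5)[OF i(1)] insert.prems(5)[OF i(2)] pq insert.hyps
        by (intro add_mono mult_left_mono) (auto simp: S1_def S2_def)
      moreover have "p * (of_int (a1 i) * y i + S1 + of_int e1 * \<delta>)
          + q * (of_int (a2 i) * y i + S2 + of_int e2 * \<delta>)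
          = (p * S1 + q * S2) + of_int e * \<delta>"
        by (simp add: eqs p_def q_def algebra_simps)
      moreover have "p * of_int c1 + q * of_int c2 = of_int c" by (simp add: eqs p_def q_def)
      ultimately show ?thesis unfolding S by simp
    qed
  qed
  have "\<exists>y'::'j \<Rightarrow> real. \<forall>(a, e, c) \<in> S'.
      (\<Sum>j\<in>J. of_int (a j) * y' j) + of_int e / (2 * of_int (2 * A\<^sup>2)) ^ (2 ^ card J) \<le> of_int c"
    by (rule insert.IH[OF fin AA(2) _ \<open>0 < \<delta>\<close>]) (erule bound, erule feas)
  then obtain y' :: "'j \<Rightarrow> real" where y': "\<And>a e c. (a, e, c) \<in> S' \<Longrightarrow>
      (\<Sum>j\<in>J. of_int (a j) * y' j) + of_int e / (2 * of_int (2 * A\<^sup>2)) ^ (2 ^ card J) \<le> of_int c"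
    by blast
  \<comment> \<open>The slack produced by the smaller system is the one claimed, since $2(2A^2) = (2A)^2$.\<close>
  define d :: real where "d = 1 / (2 * of_int A) ^ (2 ^ card (insert i J))"
  have d: "d = 1 / (2 * of_int (2 * A\<^sup>2)) ^ (2 ^ card J)"
    using insert.hyps by (simp add: d_def power_mult[symmetric] power_mult_distrib)
       (simp add: power_mult power2_eq_square)
  define r where "r = (\<lambda>(a :: 'j \<Rightarrow> int, e, c). real_of_int c - of_int e * d - (\<Sum>j\<in>J. of_int (a j) * y' j))"
  have rS': "0 \<le> r s" if "s \<in> S'" for s
    using y'[of "fst s" "fst (snd s)" "snd (snd s)"] that
    by (simp add: r_def d[symmetric] case_prod_beta) (simp add: d)
  \<comment> \<open>The bound that a constraint imposes on the eliminated unknown.\<close>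
  define bnd where "bnd = (\<lambda>s :: ('j \<Rightarrow> int) \<times> int \<times> int. r s / of_int (fst s i))"
  have sep: "x \<le> y" if xy: "x \<in> bnd ` L" "y \<in> bnd ` U" for x y
  proof -
    obtain s t where s: "s \<in> U" "y = bnd s" and t: "t \<in> L" "x = bnd t" using xy by blast
    have "0 \<le> r (comb (s, t))" using s t by (intro rS') (auto simp: S'_def)
    also have "r (comb (s, t)) = - of_int (fst t i) * r s + of_int (fst s i) * r t"
      by (simp add: r_def comb_def case_prod_beta algebra_simps sum_distrib_left sum.distrib
           sum_subtractf sum_negf)
    finally have "0 \<le> - of_int (fst t i) * r s + of_int (fst s i) * r t" .
    moreover have "0 < real_of_int (fst s i)" "real_of_int (fst t i) < 0"
      using s t by (auto simp: U_def L_def)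
    ultimately show ?thesis unfolding s t bnd_def
      by (simp add: neg_divide_le_eq pos_divide_le_eq mult.commute)
  qed
  obtain z where z: "\<And>s. s \<in> L \<Longrightarrow> bnd s \<le> z" "\<And>s. s \<in> U \<Longrightarrow> z \<le> bnd s"
  proof -
    have "finite (bnd ` L)" "finite (bnd ` U)" using finS by (auto simp: L_def U_def)
    from finite_separation[OF this sep] show ?thesis using that by blast
  qed
  have "of_int (fst s i) * z \<le> r s" if mem: "s \<in> S" for s
  proof -
    consider "s \<in> Z" | "s \<in> U" | "s \<in> L"
      using mem by (cases "fst s i" "0::int" rule: linorder_cases) (auto simp: Z_def U_def L_def)
    then show ?thesis
    proof cases
      case 1
      then show ?thesis using rS'[of s] by (auto simp: S'_def Z_def)
    next
      case 2
      then show ?thesis using z(2)[of s] by (auto simp: U_def bnd_def field_simps)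
    next
      case 3
      then show ?thesis using z(1)[of s] by (auto simp: L_def bnd_def field_simps)
    qed
  qed
  then have main: "of_int (a i) * z \<le> of_int c - of_int e * d - (\<Sum>j\<in>J. of_int (a j) * y' j)"
    if "(a, e, c) \<in> S" for a e c
    using that unfolding r_def by fastforce
  have "(\<Sum>j\<in>insert i J. of_int (a j) * (y'(i := z)) j) + of_int e * d \<le> of_int c"
    if "(a, e, c) \<in> S" for a e c
  proof -
    have "(\<Sum>j\<in>J. of_int (a j) * (y'(i := z)) j) = (\<Sum>j\<in>J. of_int (a j) * y' j)"
      using insert.hyps by (intro sum.cong) auto
    then show ?thesis using main[OF that] insert.hyps by simp
  qed
  then show ?case unfolding d_def by (intro exI[of _ "y'(i := z)"]) auto
qed

text \<open>
  On a box of integer points the floor of a real affine function coincides with the floor of an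
  affine function with a common denominator $q$ that is polynomially bounded in the side length
  $A$. The given function satisfies $f(k) \le u(k) \le f(k) + 1 - \delta$ on the box, where
  $f = \lfloor u \rfloor$ and $\delta$ may be tiny. These are inequalities
  with integer coefficients for the unknown coefficients of $u$, so they also have a solution with
  $\delta$ a power of $1/(2A)$; rounding that solution up to multiples of $1/q$ then stays inside the
  slack.
\<close>

lemma floor_affine_eq_div:
  fixes w :: "'i \<Rightarrow> real" and r :: real and A :: nat
  assumes J: "finite J" and A: "1 \<le> A"
  shows "\<exists>(p :: 'i \<Rightarrow> int) (p\<^sub>0 :: int) q. 0 < q \<and> q \<le> (A + 1) ^ (2 ^ (card J + 2) + card J) \<and>
    (\<forall>k :: 'i \<Rightarrow> int. (\<forall>j\<in>J. 0 \<le> k j \<and> k j \<le> int A) \<longrightarrow>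
       \<lfloor>(\<Sum>j\<in>J. w j * of_int (k j)) + r\<rfloor> = ((\<Sum>j\<in>J. p j * k j) + p\<^sub>0) div int q)"
proof -
  define K where "K = (J \<rightarrow>\<^sub>E {0..int A})"
  define u where "u = (\<lambda>k :: 'i \<Rightarrow> int. (\<Sum>j\<in>J. w j * of_int (k j)) + r)"
  \<comment> \<open>The unknowns are the coefficients of the affine function; index \<^const>\<open>None\<close> stands for the constant term.\<close>
  define row where "row = (\<lambda>k :: 'i \<Rightarrow> int. case_option 1 k)"
  define J' where "J' = insert None (Some ` J)"
  define S :: "(('i option \<Rightarrow> int) \<times> int \<times> int) set"
    where "S = (\<lambda>k. (\<lambda>j. - row k j, 0, - \<lfloor>u k\<rfloor>)) ` K \<union> (\<lambda>k. (row k, 1, \<lfloor>u k\<rfloor> + 1)) ` K"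
  have finK: "finite K" unfolding K_def using J by (intro finite_PiE) auto
  have sum_row: "(\<Sum>j\<in>J'. of_int (row k j) * y j) = y None + (\<Sum>j\<in>J. of_int (k j) * y (Some j))"
    for k and y :: "'i option \<Rightarrow> real"
    using J by (simp add: J'_def row_def sum.reindex)
  define \<delta> where "\<delta> = Min (insert 1 ((\<lambda>k. of_int (\<lfloor>u k\<rfloor> + 1) - u k) ` K))"
  have \<delta>: "0 < \<delta>" "\<And>k. k \<in> K \<Longrightarrow> u k + \<delta> \<le> of_int (\<lfloor>u k\<rfloor> + 1)"
  proof -
    have "0 < of_int (\<lfloor>x\<rfloor> + 1) - x" for x :: real by linarith
    then show "0 < \<delta>" unfolding \<delta>_def using finK by simp
    show "u k + \<delta> \<le> of_int (\<lfloor>u k\<rfloor> + 1)" if "k \<in> K" for k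
    proof -
      have "\<delta> \<le> of_int (\<lfloor>u k\<rfloor> + 1) - u k" unfolding \<delta>_def using finK that by (intro Min_le) auto
      then show ?thesis by simp
    qed
  qed
  have row_bound: "\<forall>j\<in>J'. \<bar>row k j\<bar> \<le> int A" if "k \<in> K" for k
    using that A unfolding J'_def row_def K_def by (fastforce simp: PiE_iff)
  have "\<exists>y::'i option \<Rightarrow> real. \<forall>(a, e, c) \<in> S.
      (\<Sum>j\<in>J'. of_int (a j) * y j) + of_int e / (2 * of_int (int A)) ^ (2 ^ card J') \<le> of_int c"
  proof (rule fourier_motzkin_gap[OF _ _ _ _ \<delta>(1)])
    show "finite J'" "finite S" using J finK by (auto simp: J'_def S_def)
    show "1 \<le> int A" using A by simp
    show "0 \<le> e \<and> e \<le> int A \<and> (\<forall>j\<in>J'. \<bar>a j\<bar> \<le> int A)" if "(a, e, c) \<in> S" for a e c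
      using that row_bound A unfolding S_def by auto
    show "(\<Sum>j\<in>J'. of_int (a j) * case_option r w j) + of_int e * \<delta> \<le> of_int c"
      if "(a, e, c) \<in> S" for a e c
    proof -
      have u: "(\<Sum>j\<in>J'. of_int (row k j) * case_option r w j) = u k" for k
        unfolding sum_row by (simp add: u_def mult.commute)
      from that show ?thesis unfolding S_def
        using \<delta>(2) by (auto simp: u sum_negf)
    qed
  qed
  then obtain y :: "'i option \<Rightarrow> real" where y: "\<And>a e c. (a, e, c) \<in> S \<Longrightarrow>
      (\<Sum>j\<in>J'. of_int (a j) * y j) + of_int e / (2 * of_int (int A)) ^ (2 ^ card J') \<le> of_int c"
    by blast
  define v where "v = (\<lambda>k :: 'i \<Rightarrow> int. y None + (\<Sum>j\<in>J. of_int (k j) * y (Some j)))"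
  define M where "M = (2 * A) ^ (2 ^ (card J + 1))"
  have cardJ': "card J' = card J + 1" using J by (simp add: J'_def card_image)
  have M: "0 < M" using A by (simp add: M_def)
  have v: "of_int \<lfloor>u k\<rfloor> \<le> v k" "v k + 1 / M \<le> of_int \<lfloor>u k\<rfloor> + 1" if "k \<in> K" for k
  proof -
    have "(\<lambda>j. - row k j, 0, - \<lfloor>u k\<rfloor>) \<in> S" "(row k, 1, \<lfloor>u k\<rfloor> + 1) \<in> S"
      using that by (auto simp: S_def)
    from this[THEN y] show "of_int \<lfloor>u k\<rfloor> \<le> v k" "v k + 1 / M \<le> of_int \<lfloor>u k\<rfloor> + 1"
      by (auto simp: sum_negf sum_row v_def cardJ' M_def)
  qed
  \<comment> \<open>Rounding up changes the value by less than $(|J| A + 1)/q = 1/M$, which is the available slack.\<close>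
  define q where "q = M * (card J * A + 1)"
  define p where "p = (\<lambda>j. \<lceil>real q * y (Some j)\<rceil>)"
  define p\<^sub>0 where "p\<^sub>0 = \<lceil>real q * y None\<rceil>"
  have q: "0 < q" using M by (simp add: q_def field_simps)
  have "q \<le> (A + 1) ^ (2 ^ (card J + 2)) * (A + 1) ^ card J"
    unfolding q_def
  proof (rule mult_le_mono)
    have "2 * A \<le> (A + 1) ^ 2" by (simp add: power2_eq_square)
    then have "M \<le> ((A + 1) ^ 2) ^ (2 ^ (card J + 1))" unfolding M_def by (rule power_mono) simp
    then show "M \<le> (A + 1) ^ (2 ^ (card J + 2))" by (simp add: power_mult[symmetric])
    have "1 + real (card J) * real A \<le> (1 + real A) ^ card J" by (rule Bernoulli_inequality) simp
    then have "real (card J * A + 1) \<le> real ((A + 1) ^ card J)" by (simp add: add.commute)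
    then show "card J * A + 1 \<le> (A + 1) ^ card J" by (simp only: of_nat_le_iff)
  qed
  then have q_le: "q \<le> (A + 1) ^ (2 ^ (card J + 2) + card J)" by (simp add: power_add)
  have main: "\<lfloor>u k\<rfloor> = ((\<Sum>j\<in>J. p j * k j) + p\<^sub>0) div int q" if k: "k \<in> K" for k
  proof -
    define U where "U = (\<Sum>j\<in>J. p j * k j) + p\<^sub>0"
    have kj: "0 \<le> k j" "k j \<le> int A" if "j \<in> J" for j using k that by (auto simp: K_def)
    have qv: "real q * v k = real q * y None + (\<Sum>j\<in>J. real q * y (Some j) * of_int (k j))"
      by (simp add: v_def distrib_left sum_distrib_left mult_ac)
    have lo: "real q * v k \<le> of_int U"
      unfolding U_def qv of_int_add of_int_sum of_int_mult p_def p\<^sub>0_def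
      by (subst add.commute, intro add_mono sum_mono mult_right_mono) (use kj in auto)
    have "of_int U < real q * v k + (real (card J) * A + 1)"
    proof -
      have "(\<Sum>j\<in>J. of_int (p j) * of_int (k j)) \<le> (\<Sum>j\<in>J. real q * y (Some j) * of_int (k j) + A)"
      proof (intro sum_mono)
        fix j assume j: "j \<in> J"
        have "of_int (p j) * real_of_int (k j) \<le> (real q * y (Some j) + 1) * of_int (k j)"
          using kj[OF j] unfolding p_def by (intro mult_right_mono) (linarith, simp)
        also have "\<dots> \<le> real q * y (Some j) * of_int (k j) + A"
          using kj[OF j] by (simp add: distrib_right)
        finally show "of_int (p j) * of_int (k j) \<le> real q * y (Some j) * of_int (k j) + A" .
      qed
      moreover have "of_int p\<^sub>0 < real q * y None + 1" unfolding p\<^sub>0_def by linarith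
      ultimately show ?thesis unfolding U_def qv by (simp add: sum.distrib)
    qed
    also have "real (card J) * A + 1 = real q / M" using M by (simp add: q_def field_simps)
    finally have hi: "of_int U < real q * (v k + 1 / M)" by (simp add: distrib_left)
    have "U div int q = \<lfloor>of_int U / real_of_int (int q)\<rfloor>"
      by (rule floor_divide_of_int_eq[symmetric])
    also have "\<dots> = \<lfloor>u k\<rfloor>"
    proof (rule floor_unique)
      show "of_int \<lfloor>u k\<rfloor> \<le> of_int U / real_of_int (int q)"
        using v(1)[OF k] lo q by (simp add: field_simps) (smt (verit) mult_left_mono of_nat_0_le_iff)
      have "of_int U / real q < v k + 1 / M" using hi q by (simp add: pos_divide_less_eq mult.commute)
      then show "of_int U / real_of_int (int q) < of_int \<lfloor>u k\<rfloor> + 1" using v(2)[OF k] by simp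
    qed
    finally show ?thesis by (simp add: U_def)
  qed
  have "\<lfloor>(\<Sum>j\<in>J. w j * of_int (k j)) + r\<rfloor> = ((\<Sum>j\<in>J. p j * k j) + p\<^sub>0) div int q"
    if k: "\<forall>j\<in>J. 0 \<le> k j \<and> k j \<le> int A" for k :: "'i \<Rightarrow> int"
  proof -
    have "restrict k J \<in> K" using k by (auto simp: K_def)
    from main[OF this] show ?thesis by (simp add: u_def)
  qed
  with q q_le show ?thesis by blast
qed

section \<open>Fourier expansion of an exponential with rounded exponent\<close>

text \<open>
  Jordan's inequality, from the concavity of the sine on $[0, \pi/2]$.
\<close>

lemma jordan_sin_ge:
  assumes "0 \<le> x" "x \<le> pi / 2"
  shows "2 * x / pi \<le> sin x"
proof -
  have "concave_on {0..pi/2} sin"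
  proof (rule f''_le0_imp_concave)
    fix x :: real assume x: "x \<in> {0..pi/2}"
    show "(sin has_real_derivative cos x) (at x)" "(cos has_real_derivative (- sin x)) (at x)"
      by (auto intro!: derivative_eq_intros)
    show "- sin x \<le> 0" using x by (auto intro!: sin_ge_zero)
  qed auto
  then have "convex_on {0..pi/2} (\<lambda>x. - sin x)" by (simp add: concave_on_def)
  from convex_onD_Icc[OF this, of "2 * x / pi"] assms show ?thesis
    by (simp add: field_simps)
qed

lemma cmod_cis_minus_1: "cmod (cis x - 1) = 2 * \<bar>sin (x / 2)\<bar>"
  using dist_exp_i_1[of x] by (simp add: cis_conv_exp)

lemma cmod_cis_minus_1_le: "cmod (cis x - 1) \<le> \<bar>x\<bar>"
  unfolding cmod_cis_minus_1 using abs_sin_x_le_abs_x[of "x / 2"] by simp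

lemma cmod_cis_minus_1_ge:
  assumes "\<bar>x\<bar> \<le> pi"
  shows "2 * \<bar>x\<bar> / pi \<le> cmod (cis x - 1)"
proof -
  have "2 * (\<bar>x\<bar> / 2) / pi \<le> sin (\<bar>x\<bar> / 2)" using assms by (intro jordan_sin_ge) auto
  also have "\<dots> \<le> \<bar>sin (x / 2)\<bar>" by (cases "x \<ge> 0") auto
  finally show ?thesis by (simp add: cmod_cis_minus_1)
qed

lemma cis_eq_1_int: "cis x = 1 \<longleftrightarrow> (\<exists>n::int. x = of_int n * 2 * pi)"
  using cos_one_2pi_int[of x] cos_one_sin_zero[of x] by (auto simp: complex_eq_iff)

lemma sum_cis_multiples:
  fixes d :: int
  assumes "0 < q"
  shows "(\<Sum>m<q. cis (2 * pi * of_int d / of_nat q * of_nat m)) = (if int q dvd d then of_nat q else 0)"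
proof -
  define z where "z = cis (2 * pi * of_int d / of_nat q)"
  have pow: "cis (2 * pi * of_int d / of_nat q * of_nat m) = z ^ m" for m
    by (simp add: z_def Complex.DeMoivre mult_ac)
  have z1: "z = 1 \<longleftrightarrow> int q dvd d"
  proof
    assume "z = 1"
    then obtain n :: int where "2 * pi * of_int d / of_nat q = of_int n * 2 * pi"
      unfolding z_def cis_eq_1_int by blast
    then have "of_int d = of_int n * real q" using assms by (simp add: field_simps)
    then have "d = n * int q" by (metis of_int_eq_iff of_int_mult of_int_of_nat_eq)
    then show "int q dvd d" by simp
  next
    assume "int q dvd d"
    then obtain n where "d = int q * n" by auto
    then show "z = 1" using assms unfolding z_def cis_eq_1_int by auto
  qed
  have zq: "z ^ q = 1"
  proof -
    have "z ^ q = cis (2 * pi * of_int d)" using assms by (simp add: z_def Complex.DeMoivre)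
    then show ?thesis unfolding cis_eq_1_int[symmetric] by (simp add: cis_eq_1_int)
  qed
  show ?thesis
    unfolding pow using z1 zq by (auto simp: geometric_sum)
qed

lemma sum_inverse_le_ln:
  assumes "0 < q"
  shows "(\<Sum>m=1..<q. 1 / real m) \<le> 1 + ln (real q)"
proof -
  obtain q' where q: "q = Suc q'" using assms gr0_implies_Suc by blast
  have "(\<Sum>m=1..<q. 1 / real m) \<le> harm q"
    unfolding harm_def inverse_eq_divide by (intro sum_mono2) auto
  moreover have "harm (Suc q') - ln (Suc q') \<le> harm (Suc 0) - ln (Suc 0)"
    using decseq_harm_diff_ln unfolding decseq_def by blast
  ultimately show ?thesis using q by (simp add: harm_expand)
qed

text \<open>
  As a function of $r$, the factor $e^{-i (r \bmod q) t/q}$ by which $e^{i \lfloor r/q \rfloor t}$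
  differs from the pure character $e^{i r t/q}$ has period $q$, so the discrete Fourier transform
  expresses it by $q$ characters. The coefficients are Dirichlet kernels
  \[ c_m = \frac1q \sum_{s<q} e^{-i s \varphi_m}, \qquad \varphi_m = (2\pi m + t)/q, \]
  which for $m \ne 0$ are at most of order $|t|/m + |t|/(q-m)$. The point of the estimate is that only the
  coefficient at $m = 0$ has no factor $|t|$: that factor pays for the logarithm when the
  expansion is later divided by $|e^{it} - 1|$.
\<close>

lemma cis_div_expansion:
  assumes q: "0 < q" and t: "\<bar>t\<bar> \<le> pi"
  shows "\<exists>c :: nat \<Rightarrow> complex.
    (\<forall>r :: int. cis (of_int (r div int q) * t) = (\<Sum>m<q. c m * cis (of_int r * ((2 * pi * of_nat m + t) / of_nat q))))
    \<and> (\<Sum>m<q. cmod (c m)) \<le> 1 + \<bar>t\<bar> * (1 + ln (real q))"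
proof -
  define \<phi> where "\<phi> = (\<lambda>m::nat. (2 * pi * of_nat m + t) / of_nat q)"
  define c where "c = (\<lambda>m. (\<Sum>s<q. cis (- (of_nat s * \<phi> m))) / of_nat q)"
  have expand: "cis (of_int (r div int q) * t) = (\<Sum>m<q. c m * cis (of_int r * \<phi> m))" for r :: int
  proof -
    define s0 where "s0 = nat (r mod int q)"
    have s0: "s0 < q" "int s0 = r mod int q" using q by (auto simp: s0_def nat_less_iff)
    have dvd: "int q dvd r - int s \<longleftrightarrow> s = s0" if "s < q" for s
    proof -
      have "int q dvd r - int s \<longleftrightarrow> r mod int q = int s mod int q" by (simp add: mod_eq_dvd_iff)
      also have "\<dots> \<longleftrightarrow> s = s0" using that s0 by auto
      finally show ?thesis .
    qed
    have "(\<Sum>m<q. c m * cis (of_int r * \<phi> m))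
        = (\<Sum>m<q. \<Sum>s<q. cis (of_int (r - int s) * \<phi> m) / of_nat q)"
      unfolding c_def sum_divide_distrib sum_distrib_right
      by (intro sum.cong refl) (simp add: cis_mult algebra_simps)
    also have "\<dots> = (\<Sum>s<q. \<Sum>m<q. cis (of_int (r - int s) * \<phi> m) / of_nat q)"
      by (rule sum.swap)
    also have "\<dots> = (\<Sum>s<q. cis (of_int (r - int s) * t / of_nat q) / of_nat q *
        (\<Sum>m<q. cis (2 * pi * of_int (r - int s) / of_nat q * of_nat m)))"
      unfolding sum_distrib_left
    proof (intro sum.cong refl)
      fix s m
      have "of_int (r - int s) * \<phi> m
        = of_int (r - int s) * t / of_nat q + 2 * pi * of_int (r - int s) / of_nat q * of_nat m"
        by (simp add: \<phi>_def add_divide_distrib diff_divide_distrib algebra_simps)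
      then show "cis (of_int (r - int s) * \<phi> m) / of_nat q
        = cis (of_int (r - int s) * t / of_nat q) / of_nat q
           * cis (2 * pi * of_int (r - int s) / of_nat q * of_nat m)"
        by (simp only: cis_mult[symmetric] times_divide_eq_left)
    qed
    also have "\<dots> = (\<Sum>s<q. if s = s0 then cis (of_int (r - int s) * t / of_nat q) else 0)"
      unfolding sum_cis_multiples[OF q] using q dvd by (intro sum.cong refl) auto
    also have "\<dots> = cis (of_int (r - int s0) * t / of_nat q)" using s0 by simp
    also have "r - int s0 = int q * (r div int q)"
      using s0 by (simp add: minus_mod_eq_mult_div)
    also have "of_int (int q * (r div int q)) * t / of_nat q = of_int (r div int q) * t"
      using q by simp
    finally show ?thesis by simp
  qed
  have c0: "cmod (c 0) \<le> 1"
  proof -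
    have "cmod (\<Sum>s<q. cis (- (of_nat s * \<phi> 0))) \<le> (\<Sum>s<q. cmod (cis (- (of_nat s * \<phi> 0))))"
      by (rule norm_sum)
    then show ?thesis using q by (simp add: c_def norm_divide)
  qed
  have cm: "cmod (c m) \<le> \<bar>t\<bar> / 2 * (1 / real m + 1 / real (q - m))" if m: "1 \<le> m" "m < q" for m
  proof -
    define x where "x = \<phi> m / 2"
    \<comment> \<open>The distance of $\varphi_m / 2$ to the zeros $0$ and $\pi$ of the sine is at least $\pi \mu / q$, because $|t| \le \pi$.\<close>
    define \<mu> where "\<mu> = min (real m) (real (q - m)) / 2"
    have qm: "real (q - m) = real q - real m" using m by (simp add: of_nat_diff)
    have xq: "x * q = pi * m + t / 2" using q by (simp add: x_def \<phi>_def)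
    have m1: "real m \<ge> 1" "real q - real m \<ge> 1" using m by linarith+
    have pim: "pi * real m \<ge> pi" "pi * (real q - real m) \<ge> pi"
      using mult_left_mono[OF m1(1), of pi] mult_left_mono[OF m1(2), of pi] by simp_all
    have x_lo: "pi * \<mu> \<le> x * q"
    proof -
      have "pi * \<mu> \<le> pi * (real m / 2)" unfolding \<mu>_def by (intro mult_left_mono) auto
      also have "\<dots> \<le> x * q" using pim t unfolding xq by linarith
      finally show ?thesis .
    qed
    have x_hi: "pi * \<mu> \<le> (pi - x) * q"
    proof -
      have "pi * \<mu> \<le> pi * ((real q - real m) / 2)" unfolding \<mu>_def qm by (intro mult_left_mono) auto
      also have "\<dots> = (pi * real q - pi * real m) / 2" by (simp add: right_diff_distrib)
      also have "\<dots> \<le> pi * real q - (pi * real m + t / 2)"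
        using pim(2)[unfolded right_diff_distrib] t by (simp add: abs_le_iff field_simps)
      also have "\<dots> = (pi - x) * q" unfolding xq[symmetric] by (simp add: left_diff_distrib)
      finally show ?thesis .
    qed
    have \<mu>: "\<mu> > 0" using m by (auto simp: \<mu>_def)
    have x_pos: "0 \<le> x" "0 \<le> pi - x"
      using x_lo x_hi \<mu> q by (smt (verit) mult_neg_pos mult_pos_pos of_nat_0_less_iff pi_gt_zero)+
    have "2 * (\<mu> / q) \<le> sin x"
    proof (cases "x \<le> pi / 2")
      case True
      have "\<mu> / q \<le> x / pi" using x_lo q by (simp add: field_simps)
      then show ?thesis using jordan_sin_ge[OF x_pos(1) True] by simp
    next
      case False
      have "\<mu> / q \<le> (pi - x) / pi" using x_hi q by (simp add: field_simps)
      moreover have "2 * (pi - x) / pi \<le> sin (pi - x)"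
        using False x_pos by (intro jordan_sin_ge) auto
      ultimately show ?thesis by (simp add: diff_divide_distrib)
    qed
    define z where "z = cis (- \<phi> m)"
    have "2 * (\<mu> / q) > 0" using \<mu> q by simp
    then have zge: "4 * (\<mu> / q) \<le> cmod (z - 1)" "cmod (z - 1) > 0"
      using \<open>2 * (\<mu> / q) \<le> sin x\<close> unfolding z_def cmod_cis_minus_1 x_def by auto
    have z1: "z \<noteq> 1" using zge by auto
    have "(\<Sum>s<q. cis (- (of_nat s * \<phi> m))) = (\<Sum>s<q. z ^ s)"
      by (simp add: z_def Complex.DeMoivre)
    also have "\<dots> = (z ^ q - 1) / (z - 1)" using z1 by (rule geometric_sum)
    also have "z ^ q = cis (- t)"
    proof -
      have "real q * (- \<phi> m) = - t + of_int (- int m) * 2 * pi"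
        using q by (simp add: \<phi>_def field_simps)
      then have "z ^ q = cis (- t + of_int (- int m) * 2 * pi)"
        by (simp only: z_def Complex.DeMoivre)
      also have "\<dots> = cis (- t) * cis (of_int (- int m) * 2 * pi)" by (simp add: cis_mult)
      also have "cis (of_int (- int m) * 2 * pi) = 1" unfolding cis_eq_1_int by blast
      finally show ?thesis by simp
    qed
    finally have "cmod (c m) = cmod (cis (- t) - 1) / cmod (z - 1) / q"
      by (simp add: c_def norm_divide norm_mult)
    also have "\<dots> \<le> \<bar>t\<bar> / (4 * (\<mu> / q)) / q"
      using cmod_cis_minus_1_le[of "- t"] zge \<mu> q by (intro divide_right_mono frac_le) auto
    also have "\<dots> = \<bar>t\<bar> / 2 * (1 / (2 * \<mu>))" using q \<mu> by simp
    also have "1 / (2 * \<mu>) \<le> 1 / real m + 1 / real (q - m)"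
      using m by (auto simp: \<mu>_def min_def)
    finally show ?thesis by (simp add: mult_left_mono)
  qed
  have "(\<Sum>m<q. cmod (c m)) = cmod (c 0) + (\<Sum>m=1..<q. cmod (c m))"
    using q by (simp add: lessThan_atLeast0 sum.atLeast_Suc_lessThan)
  also have "\<dots> \<le> 1 + (\<Sum>m=1..<q. \<bar>t\<bar> / 2 * (1 / real m + 1 / real (q - m)))"
    using c0 cm by (intro add_mono sum_mono) auto
  also have "(\<Sum>m=1..<q. \<bar>t\<bar> / 2 * (1 / real m + 1 / real (q - m)))
      = \<bar>t\<bar> / 2 * ((\<Sum>m=1..<q. 1 / real m) + (\<Sum>m=1..<q. 1 / real (q - m)))"
    by (simp only: sum_distrib_left[symmetric] sum.distrib)
  also have "(\<Sum>m=1..<q. 1 / real (q - m)) = (\<Sum>m=1..<q. 1 / real m)"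
    by (rule sum.reindex_bij_witness[of _ "\<lambda>m. q - m" "\<lambda>m. q - m"]) auto
  also have "\<bar>t\<bar> / 2 * ((\<Sum>m=1..<q. 1 / real m) + (\<Sum>m=1..<q. 1 / real m))
     \<le> \<bar>t\<bar> * (1 + ln (real q))"
    using mult_left_mono[OF sum_inverse_le_ln[OF q], of "\<bar>t\<bar>"] by simp
  finally have "(\<Sum>m<q. cmod (c m)) \<le> 1 + \<bar>t\<bar> * (1 + ln (real q))" by simp
  with expand show ?thesis by (intro exI[of _ c]) (simp add: \<phi>_def)
qed

section \<open>The $L^1$ norm on the torus\<close>

text \<open>
  The norm of a trigonometric polynomial in $L^1((-\pi,\pi]^J)$, without normalising factor.
  Frequencies are functions on an arbitrary index set, so that coordinates can be split off in any
  order; the cube is an indicator in the integrand, which leaves the measure a plain product of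
  Lebesgue measures.
\<close>

definition torus_norm :: "'i set \<Rightarrow> ('i \<Rightarrow> int) set \<Rightarrow> (('i \<Rightarrow> int) \<Rightarrow> complex) \<Rightarrow> ennreal" where
  "torus_norm J B c =
     (\<integral>\<^sup>+x. ennreal (cmod (\<Sum>k\<in>B. c k * cis (\<Sum>j\<in>J. of_int (k j) * x j)))
        * (\<Prod>j\<in>J. indicator {-pi<..pi} (x j)) \<partial>(PiM J (\<lambda>_. lborel :: real measure)))"

lemma cis_measurable [measurable]: "cis \<in> borel_measurable borel"
  by (intro borel_measurable_continuous_onI continuous_intros)

lemma trig_poly_measurable:
  assumes "finite J"
  shows "(\<lambda>x. \<Sum>k\<in>B. c k * cis (\<Sum>j\<in>J. of_int (k j) * x j)) \<in> borel_measurable (PiM J (\<lambda>_. lborel :: real measure))"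
proof (intro borel_measurable_sum borel_measurable_times measurable_compose[OF _ cis_measurable])
  fix k :: "'a \<Rightarrow> int" and j assume "j \<in> J"
  show "(\<lambda>x. x j) \<in> borel_measurable (PiM J (\<lambda>_. lborel :: real measure))"
    using measurable_component_singleton[OF \<open>j \<in> J\<close>, of "\<lambda>_. lborel"] by simp
qed auto

lemma cube_measurable:
  assumes "finite J"
  shows "(\<lambda>x. (\<Prod>j\<in>J. indicator {-pi<..pi} (x j)) :: ennreal) \<in> borel_measurable (PiM J (\<lambda>_. lborel :: real measure))"
proof (intro borel_measurable_prod_ennreal measurable_compose[OF _ borel_measurable_indicator])
  fix j assume "j \<in> J"
  show "(\<lambda>x. x j) \<in> PiM J (\<lambda>_. lborel :: real measure) \<rightarrow>\<^sub>M borel"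
    using measurable_component_singleton[OF \<open>j \<in> J\<close>, of "\<lambda>_. lborel"] by simp
qed auto

lemma torus_norm_integrand_measurable:
  assumes "finite J"
  shows "(\<lambda>x. ennreal (cmod (\<Sum>k\<in>B. c k * cis (\<Sum>j\<in>J. of_int (k j) * x j)))
        * (\<Prod>j\<in>J. indicator {-pi<..pi} (x j))) \<in> borel_measurable (PiM J (\<lambda>_. lborel :: real measure))"
  using trig_poly_measurable[OF assms] cube_measurable[OF assms] by measurable

lemma torus_norm_cong: "(\<And>k. k \<in> B \<Longrightarrow> c k = c' k) \<Longrightarrow> torus_norm J B c = torus_norm J B c'"
  unfolding torus_norm_def by (simp cong: sum.cong)

lemma torus_norm_sum_le:
  assumes "finite J" "finite I"
  shows "torus_norm J B (\<lambda>k. \<Sum>i\<in>I. c i k) \<le> (\<Sum>i\<in>I. torus_norm J B (c i))"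
proof -
  define \<Phi> where "\<Phi> = (\<lambda>d (x::'a \<Rightarrow> real). \<Sum>k\<in>B. d k * cis (\<Sum>j\<in>J. of_int (k j) * x j))"
  have \<Phi>: "\<Phi> (\<lambda>k. \<Sum>i\<in>I. c i k) x = (\<Sum>i\<in>I. \<Phi> (c i) x)" for x
    unfolding \<Phi>_def sum_distrib_right by (rule sum.swap)
  have norm_\<Phi>: "torus_norm J B d = (\<integral>\<^sup>+x. ennreal (cmod (\<Phi> d x)) * (\<Prod>j\<in>J. indicator {-pi<..pi} (x j))
      \<partial>(PiM J (\<lambda>_. lborel :: real measure)))" for d
    by (simp add: torus_norm_def \<Phi>_def)
  have "torus_norm J B (\<lambda>k. \<Sum>i\<in>I. c i k) \<le>
    (\<integral>\<^sup>+x. (\<Sum>i\<in>I. ennreal (cmod (\<Phi> (c i) x)) * (\<Prod>j\<in>J. indicator {-pi<..pi} (x j)))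
      \<partial>(PiM J (\<lambda>_. lborel :: real measure)))"
    unfolding norm_\<Phi> \<Phi> sum_distrib_right[symmetric]
    by (intro nn_integral_mono mult_right_mono) (auto simp: ennreal_leI norm_sum)
  also have "\<dots> = (\<Sum>i\<in>I. torus_norm J B (c i))"
    unfolding torus_norm_def \<Phi>_def
    by (rule nn_integral_sum) (rule torus_norm_integrand_measurable[OF assms(1)])
  finally show ?thesis .
qed

lemma torus_norm_add_le:
  assumes "finite J"
  shows "torus_norm J B (\<lambda>k. c k + c' k) \<le> torus_norm J B c + torus_norm J B c'"
  using torus_norm_sum_le[OF assms, of "UNIV :: bool set" B "\<lambda>b. if b then c else c'"]
  by (simp add: UNIV_bool add.commute)

lemma torus_norm_cmult:
  assumes "finite J"
  shows "torus_norm J B (\<lambda>k. a * c k) = ennreal (cmod a) * torus_norm J B c"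
proof -
  have "torus_norm J B (\<lambda>k. a * c k) =
    (\<integral>\<^sup>+x. ennreal (cmod a) * (ennreal (cmod (\<Sum>k\<in>B. c k * cis (\<Sum>j\<in>J. of_int (k j) * x j)))
        * (\<Prod>j\<in>J. indicator {-pi<..pi} (x j))) \<partial>(PiM J (\<lambda>_. lborel :: real measure)))"
    unfolding torus_norm_def mult.assoc sum_distrib_left[symmetric] norm_mult
    by (simp add: ennreal_mult' mult.assoc)
  also have "\<dots> = ennreal (cmod a) * torus_norm J B c"
    unfolding torus_norm_def by (rule nn_integral_cmult) (rule torus_norm_integrand_measurable[OF assms(1)])
  finally show ?thesis .
qed

lemma torus_norm_insert:
  assumes "finite J" "j \<notin> J"
  shows "torus_norm (insert j J) (PiE (insert j J) F) c =
    (\<integral>\<^sup>+t. torus_norm J (PiE J F) (\<lambda>k. \<Sum>v\<in>F j. c (k(j := v)) * cis (of_int v * t))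
       * indicator {-pi<..pi} t \<partial>lborel)"
proof -
  interpret product_sigma_finite "\<lambda>_::'a. lborel :: real measure" ..
  have sum_eq: "(\<Sum>k\<in>PiE (insert j J) F. c k * cis (\<Sum>i\<in>insert j J. of_int (k i) * (x(j := t)) i))
     = (\<Sum>k\<in>PiE J F. (\<Sum>v\<in>F j. c (k(j := v)) * cis (of_int v * t)) * cis (\<Sum>i\<in>J. of_int (k i) * x i))"
    for x :: "'a \<Rightarrow> real" and t
  proof -
    have "(\<Sum>k\<in>PiE (insert j J) F. c k * cis (\<Sum>i\<in>insert j J. of_int (k i) * (x(j := t)) i))
      = (\<Sum>(v, k)\<in>F j \<times> PiE J F. c (k(j := v)) * cis (\<Sum>i\<in>insert j J. of_int ((k(j := v)) i) * (x(j := t)) i))"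
      unfolding PiE_insert_eq
      by (subst sum.reindex) (use inj_combinator[OF assms(2)] in \<open>auto intro!: sum.cong\<close>)
    also have "\<dots> = (\<Sum>(v, k)\<in>F j \<times> PiE J F. c (k(j := v)) * cis (of_int v * t) * cis (\<Sum>i\<in>J. of_int (k i) * x i))"
    proof -
      have "(\<Sum>i\<in>J. of_int ((k(j := v)) i) * (x(j := t)) i) = (\<Sum>i\<in>J. of_int (k i) * x i)" for v k
        using assms(2) by (intro sum.cong) auto
      then show ?thesis using assms by (simp add: cis_mult mult.assoc)
    qed
    also have "\<dots> = (\<Sum>k\<in>PiE J F. \<Sum>v\<in>F j. c (k(j := v)) * cis (of_int v * t) * cis (\<Sum>i\<in>J. of_int (k i) * x i))"
      unfolding sum.cartesian_product[symmetric] by (rule sum.swap)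
    finally show ?thesis by (simp add: sum_distrib_right)
  qed
  have prod_eq: "(\<Prod>i\<in>insert j J. indicator {-pi<..pi} ((x(j := t)) i))
    = (\<Prod>i\<in>J. indicator {-pi<..pi} (x i)) * (indicator {-pi<..pi} t :: ennreal)" for x :: "'a \<Rightarrow> real" and t
  proof -
    have "(\<Prod>i\<in>J. indicator {-pi<..pi} ((x(j := t)) i)) = (\<Prod>i\<in>J. indicator {-pi<..pi} (x i) :: ennreal)"
      using assms(2) by (intro prod.cong) auto
    then show ?thesis using assms by (simp add: mult.commute)
  qed
  show ?thesis
    unfolding torus_norm_def
    apply (subst product_nn_integral_insert_rev)
    using assms apply (simp, simp)
    using assms(1) apply (intro torus_norm_integrand_measurable, simp)
    unfolding sum_eq prod_eq mult.assoc[symmetric]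
    by (subst nn_integral_multc[OF torus_norm_integrand_measurable[OF assms(1)]]) simp
qed

lemma nn_integral_periodic_shift:
  fixes g :: "real \<Rightarrow> ennreal"
  assumes [measurable]: "g \<in> borel_measurable borel" and periodic: "\<And>y. g (y + 2 * pi) = g y"
  shows "(\<integral>\<^sup>+y. g (y + \<theta>) * indicator {-pi<..pi} y \<partial>lborel) = (\<integral>\<^sup>+y. g y * indicator {-pi<..pi} y \<partial>lborel)"
proof -
  have "g (y + of_nat m * (2 * pi)) = g y" for y and m :: nat
  proof (induction m)
    case (Suc m)
    have "g (y + of_nat (Suc m) * (2 * pi)) = g ((y + of_nat m * (2 * pi)) + 2 * pi)"
      by (simp add: algebra_simps)
    then show ?case using Suc periodic by metis
  qed simp
  note nat = this
  have per: "g (y + of_int m * (2 * pi)) = g y" for y and m :: int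
  proof (cases "m \<ge> 0")
    case True
    then show ?thesis using nat[of y "nat m"] by simp
  next
    case False
    then show ?thesis using nat[of "y + of_int m * (2 * pi)" "nat (- m)"] by (simp add: algebra_simps)
  qed
  define \<theta>' where "\<theta>' = \<theta> - of_int \<lfloor>\<theta> / (2 * pi)\<rfloor> * (2 * pi)"
  have \<theta>': "0 \<le> \<theta>'" "\<theta>' \<le> 2 * pi"
    using floor_divide_lower[of "2 * pi" \<theta>] floor_divide_upper[of "2 * pi" \<theta>]
    by (auto simp: \<theta>'_def algebra_simps)
  have "(\<integral>\<^sup>+y. g (y + \<theta>) * indicator {-pi<..pi} y \<partial>lborel) = (\<integral>\<^sup>+y. g (y + \<theta>') * indicator {-pi<..pi} y \<partial>lborel)"
    using per[of _ "\<lfloor>\<theta> / (2 * pi)\<rfloor>"] by (intro nn_integral_cong) (simp add: \<theta>'_def, metis add_diff_eq diff_add_cancel)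
  also have "\<dots> = (\<integral>\<^sup>+y. g y * indicator {-pi + \<theta>'<..pi + \<theta>'} y \<partial>lborel)"
    by (subst nn_integral_real_affine[of _ 1 \<theta>'])
       (auto intro!: nn_integral_cong simp: indicator_def add.commute)
  also have "\<dots> = (\<integral>\<^sup>+y. g y * indicator {-pi + \<theta>'<..pi} y \<partial>lborel) + (\<integral>\<^sup>+y. g y * indicator {pi<..pi + \<theta>'} y \<partial>lborel)"
    by (subst nn_integral_add[symmetric]) (use \<theta>' in \<open>auto intro!: nn_integral_cong simp: indicator_def\<close>)
  also have "(\<integral>\<^sup>+y. g y * indicator {pi<..pi + \<theta>'} y \<partial>lborel) = (\<integral>\<^sup>+y. g y * indicator {-pi<..-pi + \<theta>'} y \<partial>lborel)"
    by (subst nn_integral_real_affine[of _ 1 "2 * pi"])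
       (auto intro!: nn_integral_cong simp: indicator_def periodic add.commute)
  also have "(\<integral>\<^sup>+y. g y * indicator {-pi + \<theta>'<..pi} y \<partial>lborel) + (\<integral>\<^sup>+y. g y * indicator {-pi<..-pi + \<theta>'} y \<partial>lborel)
     = (\<integral>\<^sup>+y. g y * indicator {-pi<..pi} y \<partial>lborel)"
    by (subst nn_integral_add[symmetric]) (use \<theta>' in \<open>auto intro!: nn_integral_cong simp: indicator_def\<close>)
  finally show ?thesis .
qed

text \<open>
  Multiplying the coefficients by a character translates the polynomial on the torus, which
  preserves the norm.
\<close>

lemma torus_norm_shift_coordinate:
  assumes "finite J" "j \<in> J"
  shows "torus_norm J B (\<lambda>k. c k * cis (of_int (k j) * \<theta>)) = torus_norm J B c"
proof -
  interpret product_sigma_finite "\<lambda>_::'a. lborel :: real measure" ..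
  define J0 where "J0 = J - {j}"
  have J0: "J = insert j J0" "finite J0" "j \<notin> J0" using assms by (auto simp: J0_def)
  define G where "G = (\<lambda>x y. \<Sum>k\<in>B. c k * cis (of_int (k j) * y + (\<Sum>i\<in>J0. of_int (k i) * x i)))"
  have G: "(\<lambda>y. ennreal (cmod (G x y))) \<in> borel_measurable borel" for x :: "'a \<Rightarrow> real"
    unfolding G_def by measurable
  have sum_eq: "(\<Sum>i\<in>J. of_int (k i) * (x(j := y)) i) = of_int (k j) * y + (\<Sum>i\<in>J0. of_int (k i) * x i)"
    for k :: "'a \<Rightarrow> int" and x y
  proof -
    have "(\<Sum>i\<in>J0. of_int (k i) * (x(j := y)) i) = (\<Sum>i\<in>J0. of_int (k i) * x i)"
      using J0 by (intro sum.cong) auto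
    then show ?thesis using J0 by simp
  qed
  have prod_eq: "(\<Prod>i\<in>J. indicator {-pi<..pi} ((x(j := t)) i))
    = (\<Prod>i\<in>J0. indicator {-pi<..pi} (x i)) * (indicator {-pi<..pi} t :: ennreal)" for x :: "'a \<Rightarrow> real" and t
  proof -
    have "(\<Prod>i\<in>J0. indicator {-pi<..pi} ((x(j := t)) i)) = (\<Prod>i\<in>J0. indicator {-pi<..pi} (x i) :: ennreal)"
      using J0 by (intro prod.cong) auto
    then show ?thesis using J0 by (simp add: mult.commute)
  qed
  have norm_eq: "torus_norm J B (\<lambda>k. c k * cis (of_int (k j) * \<theta>)) =
    (\<integral>\<^sup>+x. (\<Prod>i\<in>J0. indicator {-pi<..pi} (x i)) *
        (\<integral>\<^sup>+y. ennreal (cmod (G x (y + \<theta>))) * indicator {-pi<..pi} y \<partial>lborel) \<partial>(PiM J0 (\<lambda>_. lborel)))" for \<theta>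
  proof -
    have G_eq: "(\<Sum>k\<in>B. c k * cis (of_int (k j) * \<theta>) * cis (\<Sum>i\<in>J. of_int (k i) * (x(j := y)) i)) = G x (y + \<theta>)" for x y
      unfolding sum_eq G_def by (intro sum.cong refl) (simp add: cis_mult mult.assoc distrib_left add_ac)
    have meas: "(\<lambda>y. ennreal (cmod (G x (y + \<theta>))) * indicator {-pi<..pi} y) \<in> borel_measurable lborel" for x
      using G[of x] by measurable
    have "torus_norm J B (\<lambda>k. c k * cis (of_int (k j) * \<theta>)) =
      (\<integral>\<^sup>+x. \<integral>\<^sup>+y. ennreal (cmod (\<Sum>k\<in>B. c k * cis (of_int (k j) * \<theta>) * cis (\<Sum>i\<in>J. of_int (k i) * (x(j := y)) i)))
        * (\<Prod>i\<in>J. indicator {-pi<..pi} ((x(j := y)) i)) \<partial>lborel \<partial>(PiM J0 (\<lambda>_. lborel)))"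
      unfolding torus_norm_def
      by (rule product_nn_integral_insert[OF J0(2,3), folded J0(1)])
         (rule torus_norm_integrand_measurable[OF assms(1)])
    also have "\<dots> = (\<integral>\<^sup>+x. \<integral>\<^sup>+y. (\<Prod>i\<in>J0. indicator {-pi<..pi} (x i)) *
        (ennreal (cmod (G x (y + \<theta>))) * indicator {-pi<..pi} y) \<partial>lborel \<partial>(PiM J0 (\<lambda>_. lborel)))"
      unfolding G_eq prod_eq by (simp add: mult_ac)
    finally show ?thesis using meas by (simp add: nn_integral_cmult)
  qed
  have "(\<integral>\<^sup>+y. ennreal (cmod (G x (y + \<theta>))) * indicator {-pi<..pi} y \<partial>lborel)
    = (\<integral>\<^sup>+y. ennreal (cmod (G x (y + 0))) * indicator {-pi<..pi} y \<partial>lborel)" for x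
  proof -
    have "G x (y + 2 * pi) = G x y" for y
    proof -
      have "cis (of_int (k j) * (y + 2 * pi) + S) = cis (of_int (k j) * y + S)" for k :: "'a \<Rightarrow> int" and S
      proof -
        have "cis (of_int (k j) * (y + 2 * pi) + S) = cis (of_int (k j) * y + S) * cis (2 * pi * of_int (k j))"
          by (simp add: cis_mult algebra_simps)
        then show ?thesis by (simp add: cis_multiple_2pi)
      qed
      then show ?thesis by (simp add: G_def)
    qed
    then show ?thesis using nn_integral_periodic_shift[OF G, of x \<theta>] by simp
  qed
  with norm_eq[of \<theta>] norm_eq[of 0] show ?thesis by simp
qed

lemma torus_norm_shift:
  assumes "finite J" "S \<subseteq> J"
  shows "torus_norm J B (\<lambda>k. c k * cis (\<Sum>j\<in>S. of_int (k j) * \<theta> j)) = torus_norm J B c"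
proof -
  have "finite S" using assms finite_subset by blast
  then show ?thesis using assms(2)
  proof (induction S arbitrary: c)
    case (insert j S)
    have "torus_norm J B (\<lambda>k. c k * cis (\<Sum>i\<in>insert j S. of_int (k i) * \<theta> i))
      = torus_norm J B (\<lambda>k. c k * cis (of_int (k j) * \<theta> j) * cis (\<Sum>i\<in>S. of_int (k i) * \<theta> i))"
      using insert.hyps by (simp add: cis_mult mult.assoc)
    also have "\<dots> = torus_norm J B c"
      using insert assms(1) by (simp add: torus_norm_shift_coordinate)
    finally show ?case .
  qed simp
qed

section \<open>Modulation by the floor of an affine function\<close>

text \<open>
  Modulating the coefficients by $e^{i \lfloor u(k) \rfloor t}$, with $u$ affine, costs only
  $1 + O(|t| \log(N+1))$. The floor may be computed with a denominator $q$ that is polynomial in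
  $N$; the discrete Fourier expansion turns the modulation into a combination of translations, and
  $\log q = O(\log(N+1))$ bounds the coefficient sum. The logarithm involves the \<^emph>\<open>largest\<close> side of
  the box, which is why the coordinate split off in the induction below is one of largest side.
\<close>

lemma torus_norm_floor_modulation:
  fixes w :: "'i \<Rightarrow> real" and N r t :: real
  assumes J: "finite J" and N: "1 \<le> N" and F: "\<And>j. j \<in> J \<Longrightarrow> F j \<subseteq> {0..\<lfloor>N\<rfloor>}" and t: "\<bar>t\<bar> \<le> pi"
  shows "torus_norm J (PiE J F) (\<lambda>k. \<phi> k * cis (of_int \<lfloor>(\<Sum>j\<in>J. w j * of_int (k j)) + r\<rfloor> * t))
    \<le> ennreal (1 + \<bar>t\<bar> * (1 + (2 ^ (card J + 2) + card J) * ln (N + 1))) * torus_norm J (PiE J F) \<phi>"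
proof -
  define A where "A = nat \<lfloor>N\<rfloor>"
  have A: "1 \<le> A" "int A = \<lfloor>N\<rfloor>" "real A \<le> N" using N by (auto simp: A_def le_nat_iff)
  obtain p :: "'i \<Rightarrow> int" and p\<^sub>0 :: int and q :: nat where
    q: "0 < q" "q \<le> (A + 1) ^ (2 ^ (card J + 2) + card J)" and
    fl: "\<And>k :: 'i \<Rightarrow> int. \<forall>j\<in>J. 0 \<le> k j \<and> k j \<le> int A \<Longrightarrow>
       \<lfloor>(\<Sum>j\<in>J. w j * of_int (k j)) + r\<rfloor> = ((\<Sum>j\<in>J. p j * k j) + p\<^sub>0) div int q"
    using floor_affine_eq_div[OF J A(1), of w r] by blast
  obtain c :: "nat \<Rightarrow> complex" where
    c: "\<And>r :: int. cis (of_int (r div int q) * t) = (\<Sum>m<q. c m * cis (of_int r * ((2 * pi * of_nat m + t) / of_nat q)))"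
    "(\<Sum>m<q. cmod (c m)) \<le> 1 + \<bar>t\<bar> * (1 + ln (real q))"
    using cis_div_expansion[OF q(1) t] by blast
  define \<theta> where "\<theta> = (\<lambda>m::nat. (2 * pi * of_nat m + t) / of_nat q)"
  have eq: "\<phi> k * cis (of_int \<lfloor>(\<Sum>j\<in>J. w j * of_int (k j)) + r\<rfloor> * t)
    = (\<Sum>m<q. (c m * cis (of_int p\<^sub>0 * \<theta> m)) * (\<phi> k * cis (\<Sum>j\<in>J. of_int (k j) * (of_int (p j) * \<theta> m))))"
    if "k \<in> PiE J F" for k
  proof -
    have "\<forall>j\<in>J. 0 \<le> k j \<and> k j \<le> int A"
      using F PiE_mem[OF that] A(2) by fastforce
    from fl[OF this] have "cis (of_int \<lfloor>(\<Sum>j\<in>J. w j * of_int (k j)) + r\<rfloor> * t)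
        = (\<Sum>m<q. c m * cis (of_int ((\<Sum>j\<in>J. p j * k j) + p\<^sub>0) * \<theta> m))"
      by (simp only: c(1) \<theta>_def)
    moreover have "cis (of_int ((\<Sum>j\<in>J. p j * k j) + p\<^sub>0) * \<theta> m)
       = cis (of_int p\<^sub>0 * \<theta> m) * cis (\<Sum>j\<in>J. of_int (k j) * (of_int (p j) * \<theta> m))" for m
      by (simp add: cis_mult distrib_left sum_distrib_left mult_ac add.commute)
    ultimately show ?thesis
      by (simp only: sum_distrib_left) (simp only: mult_ac)
  qed
  have "torus_norm J (PiE J F) (\<lambda>k. \<phi> k * cis (of_int \<lfloor>(\<Sum>j\<in>J. w j * of_int (k j)) + r\<rfloor> * t))
     = torus_norm J (PiE J F) (\<lambda>k. \<Sum>m<q. (c m * cis (of_int p\<^sub>0 * \<theta> m)) *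
          (\<phi> k * cis (\<Sum>j\<in>J. of_int (k j) * (of_int (p j) * \<theta> m))))"
    by (rule torus_norm_cong) (rule eq)
  also have "\<dots> \<le> (\<Sum>m<q. torus_norm J (PiE J F) (\<lambda>k. (c m * cis (of_int p\<^sub>0 * \<theta> m)) *
          (\<phi> k * cis (\<Sum>j\<in>J. of_int (k j) * (of_int (p j) * \<theta> m)))))"
    by (rule torus_norm_sum_le) (use J in auto)
  also have "\<dots> = (\<Sum>m<q. ennreal (cmod (c m)) * torus_norm J (PiE J F) \<phi>)"
    using J by (simp add: torus_norm_cmult torus_norm_shift norm_mult)
  also have "\<dots> = ennreal (\<Sum>m<q. cmod (c m)) * torus_norm J (PiE J F) \<phi>"
    by (simp add: sum_distrib_right[symmetric])
  also have "\<dots> \<le> ennreal (1 + \<bar>t\<bar> * (1 + (2 ^ (card J + 2) + card J) * ln (N + 1))) * torus_norm J (PiE J F) \<phi>"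
  proof (intro mult_right_mono ennreal_leI order.trans[OF c(2)] add_mono order.refl mult_left_mono)
    have "real q \<le> (real A + 1) ^ (2 ^ (card J + 2) + card J)"
      using q(2) by (metis of_nat_1 of_nat_add of_nat_le_iff of_nat_power)
    also have "\<dots> \<le> (N + 1) ^ (2 ^ (card J + 2) + card J)" using A by (intro power_mono) auto
    finally have "ln (real q) \<le> ln ((N + 1) ^ (2 ^ (card J + 2) + card J))" using q by simp
    also have "\<dots> = real (2 ^ (card J + 2) + card J) * ln (N + 1)" using N by (simp add: ln_realpow)
    finally show "ln (real q) \<le> (2 ^ (card J + 2) + card J) * ln (N + 1)" by simp
  qed auto
  finally show ?thesis .
qed

section \<open>Integer points of polytopes and elimination of a coordinate\<close>

definition int_box :: "'i set \<Rightarrow> ('i \<Rightarrow> real) \<Rightarrow> ('i \<Rightarrow> int) set" where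
  "int_box J n = PiE J (\<lambda>j. {0..\<lfloor>n j\<rfloor>})"

text \<open>
  Affine functions are stored as pairs of a linear part and a constant, so that existence of such a
  function can be stated about its data.
\<close>

definition aff :: "'i set \<Rightarrow> ('i \<Rightarrow> real) \<times> real \<Rightarrow> ('i \<Rightarrow> int) \<Rightarrow> real" where
  "aff J f k = (\<Sum>j\<in>J. fst f j * of_int (k j)) + snd f"

text \<open>
  The integer points of a box that lie in $m$ half-spaces. Only the number of half-spaces enters the
  final bound, not their position. Working with finite point sets instead of polytopes makes open
  half-spaces as good as closed ones.
\<close>

definition cell :: "'i set \<Rightarrow> ('i \<Rightarrow> real) \<Rightarrow> nat \<Rightarrow> ('i \<Rightarrow> int) set \<Rightarrow> bool" where
  "cell J n m K \<longleftrightarrow> (\<exists>f. K = {k \<in> int_box J n. \<forall>i<m. aff J (f i) k \<le> 0})"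

lemma finite_int_box: "finite J \<Longrightarrow> finite (int_box J n)"
  unfolding int_box_def by (intro finite_PiE) auto

lemma cell_int_box: "cell J n 0 (int_box J n)"
  by (simp add: cell_def)

lemma cell_mono:
  assumes "cell J n m K" "m \<le> m'"
  shows "cell J n m' K"
proof -
  obtain f where f: "K = {k \<in> int_box J n. \<forall>i<m. aff J (f i) k \<le> 0}"
    using assms(1) by (auto simp: cell_def)
  have "(\<forall>i<m'. aff J (if i < m then f i else (\<lambda>_. 0, 0)) k \<le> 0) \<longleftrightarrow> (\<forall>i<m. aff J (f i) k \<le> 0)" for k
    using assms(2) by (auto simp: aff_def)
  then show ?thesis unfolding cell_def f
    by (intro exI[of _ "\<lambda>i. if i < m then f i else (\<lambda>_. 0, 0)"]) simp
qed

lemma cell_Int: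
  assumes "cell J n m K" "cell J n m' K'"
  shows "cell J n (m + m') (K \<inter> K')"
proof -
  obtain f g where f: "K = {k \<in> int_box J n. \<forall>i<m. aff J (f i) k \<le> 0}"
    and g: "K' = {k \<in> int_box J n. \<forall>i<m'. aff J (g i) k \<le> 0}"
    using assms by (auto simp: cell_def)
  have "(\<forall>i<m+m'. aff J (if i < m then f i else g (i - m)) k \<le> 0) \<longleftrightarrow>
    (\<forall>i<m. aff J (f i) k \<le> 0) \<and> (\<forall>i<m'. aff J (g i) k \<le> 0)" (is "?l \<longleftrightarrow> ?r") for k
  proof
    assume ?l
    have "aff J (g i) k \<le> 0" if "i < m'" for i
      using \<open>?l\<close>[rule_format, of "m + i"] that by simp
    moreover have "aff J (f i) k \<le> 0" if "i < m" for i
      using \<open>?l\<close>[rule_format, of i] that by simp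
    ultimately show ?r by blast
  qed auto
  then show ?thesis unfolding cell_def f g
    by (intro exI[of _ "\<lambda>i. if i < m then f i else g (i - m)"]) auto
qed

lemma cell_INT:
  assumes "finite I" "\<And>i. i \<in> I \<Longrightarrow> cell J n m {k \<in> int_box J n. P i k}"
  shows "cell J n (card I * m) {k \<in> int_box J n. \<forall>i\<in>I. P i k}"
  using assms
proof (induction I rule: finite_induct)
  case empty
  then show ?case using cell_int_box[of J n] by simp
next
  case (insert i I)
  have "cell J n (m + card I * m) ({k \<in> int_box J n. P i k} \<inter> {k \<in> int_box J n. \<forall>i\<in>I. P i k})"
    using insert by (intro cell_Int) auto
  also have "{k \<in> int_box J n. P i k} \<inter> {k \<in> int_box J n. \<forall>i\<in>I. P i k} = {k \<in> int_box J n. \<forall>i\<in>insert i I. P i k}"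
    by auto
  finally show ?case using insert by simp
qed

lemma cell_Collect_conj:
  assumes "cell J n m {k \<in> int_box J n. P k}" "cell J n m' {k \<in> int_box J n. Q k}"
  shows "cell J n (m + m') {k \<in> int_box J n. P k \<and> Q k}"
proof -
  have "{k \<in> int_box J n. P k \<and> Q k} = {k \<in> int_box J n. P k} \<inter> {k \<in> int_box J n. Q k}" by auto
  then show ?thesis using cell_Int[OF assms] by simp
qed

lemma aff_diff: "aff J (\<lambda>j. fst f j - fst g j, snd f - snd g) k = aff J f k - aff J g k"
  by (simp add: aff_def sum_subtractf algebra_simps)

lemma cell_le: "cell J n 1 {k \<in> int_box J n. aff J f k \<le> aff J g k}"
  unfolding cell_def by (intro exI[of _ "\<lambda>_. (\<lambda>j. fst f j - fst g j, snd f - snd g)"]) (simp add: aff_diff)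

lemma aff_const: "aff J (\<lambda>_. 0, c) k = c"
  by (simp add: aff_def)

lemma aff_insert_upd:
  assumes "finite J" "j \<notin> J"
  shows "aff (insert j J) f (k(j := v)) = aff J f k + fst f j * of_int v"
proof -
  have "(\<Sum>j'\<in>J. fst f j' * of_int ((k(j := v)) j')) = (\<Sum>j'\<in>J. fst f j' * of_int (k j'))"
    using assms by (intro sum.cong) auto
  then show ?thesis using assms by (simp add: aff_def)
qed

text \<open>
  On a finite set of points a strict inequality can be tightened to a non-strict one.
\<close>

lemma cell_less:
  assumes "finite J"
  shows "cell J n 1 {k \<in> int_box J n. aff J f k < aff J g k}"
proof -
  define h where "h = (\<lambda>j. fst f j - fst g j, snd f - snd g)"
  have h: "aff J h k = aff J f k - aff J g k" for k by (simp add: h_def aff_diff)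
  \<comment> \<open>$\varepsilon$ is negative and at least every negative value on the box; $-1$ makes the set nonempty.\<close>
  define V where "V = insert (-1) (aff J h ` int_box J n \<inter> {..<0})"
  define \<epsilon> where "\<epsilon> = Max V"
  have fin: "finite V" using finite_int_box[OF assms] by (auto simp: V_def)
  have "\<epsilon> \<in> V" unfolding \<epsilon>_def using fin by (intro Max_in) (auto simp: V_def)
  then have "\<epsilon> < 0" by (auto simp: V_def)
  have "aff J f k < aff J g k \<longleftrightarrow> aff J h k \<le> \<epsilon>" if "k \<in> int_box J n" for k
  proof
    assume "aff J f k < aff J g k"
    then have "aff J h k \<in> V" using that by (auto simp: V_def h)
    then show "aff J h k \<le> \<epsilon>" unfolding \<epsilon>_def using fin by (rule Max_ge[rotated])
  next
    assume "aff J h k \<le> \<epsilon>"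
    then show "aff J f k < aff J g k" using \<open>\<epsilon> < 0\<close> by (simp add: h)
  qed
  then have "{k \<in> int_box J n. aff J f k < aff J g k} = {k \<in> int_box J n. aff J h k \<le> aff J (\<lambda>_. 0, \<epsilon>) k}"
    unfolding aff_const by (intro Collect_cong) blast
  then show ?thesis by (simp only: cell_le)
qed

lemma cell_slice:
  assumes J: "finite J" "j \<notin> J" and K: "cell (insert j J) n m K" and v: "v \<in> {0..\<lfloor>n j\<rfloor>}"
  shows "cell J n m {k \<in> int_box J n. k(j := v) \<in> K}"
proof -
  obtain f where f: "K = {k \<in> int_box (insert j J) n. \<forall>i<m. aff (insert j J) (f i) k \<le> 0}"
    using K by (auto simp: cell_def)
  define g where "g = (\<lambda>i. (fst (f i), snd (f i) + fst (f i) j * of_int v))"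
  have g: "aff (insert j J) (f i) (k(j := v)) = aff J (g i) k" for i k
    unfolding aff_insert_upd[OF J] by (simp add: g_def aff_def)
  have "k(j := v) \<in> int_box (insert j J) n" if "k \<in> int_box J n" for k
    using that v J unfolding int_box_def by (auto simp: PiE_iff extensional_def)
  then show ?thesis unfolding cell_def f by (intro exI[of _ g]) (auto simp: g)
qed

text \<open>
  Breaking ties by the index makes the minimising affine function unique, so that the regions on
  which different ones are minimal partition the box.
\<close>

lemma unique_first_minimiser:
  fixes f :: "nat \<Rightarrow> real"
  assumes "finite U" "U \<noteq> {}"
  shows "\<exists>!u. u \<in> U \<and> (\<forall>i\<in>U. f u \<le> f i \<and> (i < u \<longrightarrow> f u < f i))"
proof -
  define W where "W = {u \<in> U. \<forall>i\<in>U. f u \<le> f i}"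
  define u where "u = (LEAST u. u \<in> W)"
  have "Min (f ` U) \<in> f ` U" using assms by (intro Min_in) auto
  then obtain u0 where "u0 \<in> U" "f u0 = Min (f ` U)" by auto
  then have "u0 \<in> W" using assms by (auto simp: W_def)
  then have uW: "u \<in> W" unfolding u_def by (rule LeastI)
  have least: "u \<le> i" if "i \<in> W" for i unfolding u_def using that by (rule Least_le)
  show ?thesis
  proof (rule ex1I[of _ u])
    show "u \<in> U \<and> (\<forall>i\<in>U. f u \<le> f i \<and> (i < u \<longrightarrow> f u < f i))"
    proof (intro conjI ballI impI)
      show "u \<in> U" "\<And>i. i \<in> U \<Longrightarrow> f u \<le> f i" using uW by (auto simp: W_def)
      show "f u < f i" if "i \<in> U" "i < u" for i
      proof (rule ccontr)
        assume "\<not> f u < f i"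
        then have fi: "f i \<le> f u" by simp
        have "f u \<le> f i'" if "i' \<in> U" for i' using uW that by (auto simp: W_def)
        with fi have "i \<in> W" using \<open>i \<in> U\<close> by (auto simp: W_def intro: order.trans)
        from least[OF this] show False using \<open>i < u\<close> by simp
      qed
    qed
    fix v assume v: "v \<in> U \<and> (\<forall>i\<in>U. f v \<le> f i \<and> (i < v \<longrightarrow> f v < f i))"
    then have "v \<in> W" by (auto simp: W_def)
    then have "u \<le> v" by (rule least)
    moreover have "\<not> u < v"
    proof
      assume "u < v"
      moreover have "u \<in> U" "v \<in> U" "f u \<le> f v" using uW v by (auto simp: W_def)
      ultimately have "f v < f u" using v by blast
      then show False using \<open>f u \<le> f v\<close> by simp
    qed
    ultimately show "v = u" by simp
  qed
qed

lemma halfline_iff: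
  fixes x a v :: real
  shows "x + a * v \<le> 0 \<longleftrightarrow> (a = 0 \<longrightarrow> x \<le> 0) \<and> (a > 0 \<longrightarrow> v \<le> - x / a) \<and> (a < 0 \<longrightarrow> - x / a \<le> v)"
proof (cases a "0::real" rule: linorder_cases)
  case less
  have "- x / a \<le> v \<longleftrightarrow> v * a \<le> - x" using less by (rule neg_divide_le_eq)
  then show ?thesis using less by (auto simp: mult.commute)
next
  case greater
  have "v \<le> - x / a \<longleftrightarrow> v * a \<le> - x" using greater by (rule pos_le_divide_eq)
  then show ?thesis using greater by (auto simp: mult.commute)
qed simp

text \<open>
  The fibre of a cell in direction $j$ is an integer interval from the largest of the lower bounds
  to the smallest of the upper bounds that the half-spaces impose on this coordinate. The box is cut
  according to which lower and which upper bound (first) attain these extrema; on each of the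
  resulting cells the interval has affine end points.
\<close>

lemma cell_fibre_decomposition:
  assumes J: "finite J" "j \<notin> J" and K: "cell (insert j J) n m K"
  obtains I :: "(nat \<times> nat) set" and \<kappa> lo up where
    "finite I" "card I \<le> (m + 1)\<^sup>2"
    "\<And>i. i \<in> I \<Longrightarrow> cell J n (5 * m + 5) (\<kappa> i)"
    "\<And>i k. i \<in> I \<Longrightarrow> k \<in> \<kappa> i \<Longrightarrow> aff J (lo i) k \<le> aff J (up i) k"
    "\<And>k (g :: int \<Rightarrow> complex). k \<in> int_box J n \<Longrightarrow>
      (\<Sum>v\<in>{0..\<lfloor>n j\<rfloor>}. of_bool (k(j := v) \<in> K) * g v)
        = (\<Sum>i\<in>I. of_bool (k \<in> \<kappa> i) * (\<Sum>v\<in>{\<lceil>aff J (lo i) k\<rceil>..\<lfloor>aff J (up i) k\<rfloor>}. g v))"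
proof -
  obtain f where f: "K = {k \<in> int_box (insert j J) n. \<forall>i<m. aff (insert j J) (f i) k \<le> 0}"
    using K by (auto simp: cell_def)
  define a where "a = (\<lambda>i. fst (f i) j)"
  define h where "h = (\<lambda>i. (\<lambda>j'. - fst (f i) j' / a i, - snd (f i) / a i))"
  \<comment> \<open>Index $m$ stands for the bounds $0$ and $n_j$ coming from the box; they make both families nonempty.\<close>
  define U where "U = insert m {i. i < m \<and> a i > 0}"
  define L where "L = insert m {i. i < m \<and> a i < 0}"
  define Z where "Z = {i. i < m \<and> a i = 0}"
  define lo where "lo = (\<lambda>i. if i = m then (\<lambda>_. 0, 0) else h i)"
  define up where "up = (\<lambda>i. if i = m then (\<lambda>_. 0, n j) else h i)"
  have fin: "finite U" "finite L" "finite Z" by (auto simp: U_def L_def Z_def)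
  have aff_insert: "aff (insert j J) (f i) (k(j := v)) = aff J (f i) k + a i * of_int v" for i k v
    unfolding aff_insert_upd[OF J] a_def ..
  have aff_h: "aff J (h i) k = - aff J (f i) k / a i" for i k
    by (simp add: h_def aff_def sum_negf sum_divide_distrib diff_divide_distrib)
  have mem: "k(j := v) \<in> K \<longleftrightarrow> (\<forall>i\<in>Z. aff J (f i) k \<le> 0) \<and>
      (\<forall>i\<in>U. of_int v \<le> aff J (up i) k) \<and> (\<forall>i\<in>L. aff J (lo i) k \<le> of_int v)"
    if k: "k \<in> int_box J n" and v: "v \<in> {0..\<lfloor>n j\<rfloor>}" for k v
  proof -
    have "k(j := v) \<in> int_box (insert j J) n"
      using k v J unfolding int_box_def by (auto simp: PiE_iff extensional_def)
    then have "k(j := v) \<in> K \<longleftrightarrow> (\<forall>i<m. aff J (f i) k + a i * of_int v \<le> 0)"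
      by (simp add: f aff_insert)
    also have "\<dots> \<longleftrightarrow> (\<forall>i<m. (a i = 0 \<longrightarrow> aff J (f i) k \<le> 0) \<and> (a i > 0 \<longrightarrow> of_int v \<le> aff J (h i) k)
        \<and> (a i < 0 \<longrightarrow> aff J (h i) k \<le> of_int v))"
      by (intro all_cong) (simp only: aff_h halfline_iff)
    also have "\<dots> \<longleftrightarrow> (\<forall>i\<in>Z. aff J (f i) k \<le> 0) \<and>
      (\<forall>i\<in>U. of_int v \<le> aff J (up i) k) \<and> (\<forall>i\<in>L. aff J (lo i) k \<le> of_int v)"
      using v by (auto simp: Z_def U_def L_def lo_def up_def aff_const le_floor_iff)
    finally show ?thesis .
  qed
  define best_up where "best_up = (\<lambda>u k. \<forall>i\<in>U. aff J (up u) k \<le> aff J (up i) k \<and> (i < u \<longrightarrow> aff J (up u) k < aff J (up i) k))"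
  define best_lo where "best_lo = (\<lambda>l k. \<forall>i\<in>L. aff J (lo i) k \<le> aff J (lo l) k \<and> (i < l \<longrightarrow> aff J (lo i) k < aff J (lo l) k))"
  define \<kappa> where "\<kappa> = (\<lambda>(l, u). {k \<in> int_box J n. (\<forall>i\<in>Z. aff J (f i) k \<le> 0) \<and> best_up u k \<and> best_lo l k
      \<and> aff J (lo l) k \<le> aff J (up u) k})"
  have cards: "card Z \<le> m" "card U \<le> m + 1" "card L \<le> m + 1"
  proof -
    have "Z \<subseteq> {..<m}" "U \<subseteq> {..m}" "L \<subseteq> {..m}" by (auto simp: Z_def U_def L_def)
    then show "card Z \<le> m" "card U \<le> m + 1" "card L \<le> m + 1"
      using card_mono[of "{..<m}" Z] card_mono[of "{..m}" U] card_mono[of "{..m}" L] by auto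
  qed
  have le0: "cell J n 1 {k \<in> int_box J n. aff J F k \<le> 0}" for F
    using cell_le[of J n F "(\<lambda>_. 0, 0)"] by (simp add: aff_const)
  have imp: "cell J n 1 {k \<in> int_box J n. b \<longrightarrow> aff J F k < aff J G k}" for b F G
    using cell_less[OF J(1)] cell_mono[OF cell_int_box[of J n], of 1] by (cases b) auto
  have \<kappa>: "cell J n (5 * m + 5) (\<kappa> i)" for i
  proof -
    obtain l u where i: "i = (l, u)" by fastforce
    \<comment> \<open>One half-space for each constraint that does not involve $k_j$, two for each comparison with a competing bound, and one for the order of the end points.\<close>
    have "cell J n (card Z * 1 + (card U * (1 + 1) + (card L * (1 + 1) + 1))) (\<kappa> i)"
      unfolding \<kappa>_def i prod.case best_up_def best_lo_def
      by (intro cell_Collect_conj cell_INT fin cell_le imp le0)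
    then show ?thesis by (rule cell_mono) (use cards in auto)
  qed
  have sum_eq: "(\<Sum>v\<in>{0..\<lfloor>n j\<rfloor>}. of_bool (k(j := v) \<in> K) * g v)
        = (\<Sum>i\<in>L \<times> U. of_bool (k \<in> \<kappa> i) * (\<Sum>v\<in>{\<lceil>aff J (lo (fst i)) k\<rceil>..\<lfloor>aff J (up (snd i)) k\<rfloor>}. g v))"
    if k: "k \<in> int_box J n" for k and g :: "int \<Rightarrow> complex"
  proof -
    have ne: "U \<noteq> {}" "L \<noteq> {}" by (auto simp: U_def L_def)
    have "\<exists>!u. u \<in> U \<and> best_up u k"
      using unique_first_minimiser[OF fin(1) ne(1), of "\<lambda>i. aff J (up i) k"] unfolding best_up_def .
    then obtain u where u: "u \<in> U" "best_up u k" and uu: "\<And>u'. u' \<in> U \<Longrightarrow> best_up u' k \<Longrightarrow> u' = u"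
      by auto
    have "\<exists>!l. l \<in> L \<and> best_lo l k"
      using unique_first_minimiser[OF fin(2) ne(2), of "\<lambda>i. - aff J (lo i) k"]
      unfolding best_lo_def neg_le_iff_le neg_less_iff_less .
    then obtain l where l: "l \<in> L" "best_lo l k" and ll: "\<And>l'. l' \<in> L \<Longrightarrow> best_lo l' k \<Longrightarrow> l' = l"
      by auto
    define zc where "zc \<longleftrightarrow> (\<forall>i\<in>Z. aff J (f i) k \<le> 0)"
    have range: "{\<lceil>aff J (lo l) k\<rceil>..\<lfloor>aff J (up u) k\<rfloor>} \<subseteq> {0..\<lfloor>n j\<rfloor>}"
    proof -
      have "0 \<le> aff J (lo l) k" using l unfolding best_lo_def L_def by (auto simp: lo_def aff_const)
      moreover have "aff J (up u) k \<le> n j" using u unfolding best_up_def U_def by (auto simp: up_def aff_const)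
      ultimately have "0 \<le> \<lceil>aff J (lo l) k\<rceil>" "\<lfloor>aff J (up u) k\<rfloor> \<le> \<lfloor>n j\<rfloor>"
        by (auto intro: floor_mono)
      then show ?thesis by auto
    qed
    have mem': "k(j := v) \<in> K \<longleftrightarrow> zc \<and> v \<in> {\<lceil>aff J (lo l) k\<rceil>..\<lfloor>aff J (up u) k\<rfloor>}" if "v \<in> {0..\<lfloor>n j\<rfloor>}" for v
    proof -
      have "(\<forall>i\<in>U. of_int v \<le> aff J (up i) k) \<longleftrightarrow> of_int v \<le> aff J (up u) k"
        using u order.trans unfolding best_up_def by blast
      moreover have "(\<forall>i\<in>L. aff J (lo i) k \<le> of_int v) \<longleftrightarrow> aff J (lo l) k \<le> of_int v"
        using l order.trans unfolding best_lo_def by blast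
      ultimately show ?thesis using mem[OF k that] by (simp add: zc_def le_floor_iff ceiling_le_iff conj_commute)
    qed
    have "(\<Sum>v\<in>{0..\<lfloor>n j\<rfloor>}. of_bool (k(j := v) \<in> K) * g v)
       = (\<Sum>v\<in>{0..\<lfloor>n j\<rfloor>}. if v \<in> {\<lceil>aff J (lo l) k\<rceil>..\<lfloor>aff J (up u) k\<rfloor>} then of_bool zc * g v else 0)"
      by (intro sum.cong refl) (simp add: mem')
    also have "\<dots> = (\<Sum>v\<in>{\<lceil>aff J (lo l) k\<rceil>..\<lfloor>aff J (up u) k\<rfloor>}. of_bool zc * g v)"
      using range by (subst sum.inter_restrict[symmetric]) (auto simp: Int_absorb1)
    also have "\<dots> = of_bool (k \<in> \<kappa> (l, u)) * (\<Sum>v\<in>{\<lceil>aff J (lo l) k\<rceil>..\<lfloor>aff J (up u) k\<rfloor>}. g v)"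
    proof (cases "aff J (lo l) k \<le> aff J (up u) k")
      case True
      then have "k \<in> \<kappa> (l, u) \<longleftrightarrow> zc" using k u l by (simp add: \<kappa>_def zc_def)
      then show ?thesis by (simp add: sum_distrib_left)
    next
      case False
      then have "\<not> \<lceil>aff J (lo l) k\<rceil> \<le> \<lfloor>aff J (up u) k\<rfloor>" by linarith
      then show ?thesis by simp
    qed
    also have "\<dots> = (\<Sum>i\<in>{(l, u)}. of_bool (k \<in> \<kappa> i) * (\<Sum>v\<in>{\<lceil>aff J (lo (fst i)) k\<rceil>..\<lfloor>aff J (up (snd i)) k\<rfloor>}. g v))"
      by simp
    also have "\<dots> = (\<Sum>i\<in>L \<times> U. of_bool (k \<in> \<kappa> i) * (\<Sum>v\<in>{\<lceil>aff J (lo (fst i)) k\<rceil>..\<lfloor>aff J (up (snd i)) k\<rfloor>}. g v))"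
    proof (rule sum.mono_neutral_left)
      show "\<forall>i\<in>L \<times> U - {(l, u)}. of_bool (k \<in> \<kappa> i) * (\<Sum>v\<in>{\<lceil>aff J (lo (fst i)) k\<rceil>..\<lfloor>aff J (up (snd i)) k\<rfloor>}. g v) = 0"
        using uu ll by (auto simp: \<kappa>_def)
    qed (use fin u(1) l(1) in simp_all)
    finally show ?thesis .
  qed
  show ?thesis
  proof (rule that)
    show "finite (L \<times> U)" using fin by simp
    show "card (L \<times> U) \<le> (m + 1)\<^sup>2"
      unfolding card_cartesian_product power2_eq_square using cards by (intro mult_le_mono)
    show "cell J n (5 * m + 5) (\<kappa> i)" for i by (rule \<kappa>)
    show "aff J (lo (fst i)) k \<le> aff J (up (snd i)) k" if "k \<in> \<kappa> i" for i k
      using that by (auto simp: \<kappa>_def)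
  qed (rule sum_eq)
qed

section \<open>Induction on the dimension\<close>

text \<open>
  The one integration that produces a logarithm.
\<close>

lemma nn_integral_log_kernel:
  assumes N: "1 \<le> (N::real)"
  shows "(\<integral>\<^sup>+t. ennreal (1 / (\<bar>t\<bar> + 1 / N)) * indicator {-pi<..pi} t \<partial>lborel) \<le> ennreal (2 * ln (1 + pi * N))"
proof -
  have pos: "0 < 1 / N" using N by simp
  have ln_eq: "ln (pi + 1 / N) - ln (1 / N) = ln (1 + pi * N)"
  proof -
    have "pi + 1 / N = (1 + pi * N) / N" using N by (simp add: field_simps)
    moreover have "0 < 1 + pi * N" using N by (simp add: add_pos_nonneg)
    ultimately show ?thesis using N by (simp add: ln_div)
  qed
  have right: "(\<integral>\<^sup>+t. ennreal (1 / (t + 1 / N)) * indicator {0..pi} t \<partial>lborel) = ennreal (ln (1 + pi * N))"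
  proof -
    have "(\<integral>\<^sup>+t. ennreal (1 / (t + 1 / N)) * indicator {0..pi} t \<partial>lborel)
       = ennreal (ln (pi + 1 / N) - ln (0 + 1 / N))"
    proof (rule nn_integral_FTC_Icc)
      fix t assume t: "t \<in> {0..pi}"
      then have "0 < t + 1 / N" using pos by (simp only: atLeastAtMost_iff) linarith
      then show "DERIV (\<lambda>t. ln (t + 1 / N)) t :> 1 / (t + 1 / N)" "0 \<le> 1 / (t + 1 / N)"
        by (auto intro!: derivative_eq_intros)
    qed auto
    then show ?thesis using ln_eq by simp
  qed
  have left: "(\<integral>\<^sup>+t. ennreal (1 / (1 / N - t)) * indicator {-pi..0} t \<partial>lborel) = ennreal (ln (1 + pi * N))"
  proof -
    have "(\<integral>\<^sup>+t. ennreal (1 / (1 / N - t)) * indicator {-pi..0} t \<partial>lborel)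
       = ennreal (- ln (1 / N - 0) - - ln (1 / N - - pi))"
    proof (rule nn_integral_FTC_Icc)
      fix t assume t: "t \<in> {-pi..0}"
      then have "0 < 1 / N - t" using pos by (simp only: atLeastAtMost_iff) linarith
      then show "DERIV (\<lambda>t. - ln (1 / N - t)) t :> 1 / (1 / N - t)" "0 \<le> 1 / (1 / N - t)"
        by (auto intro!: derivative_eq_intros)
    qed auto
    then show ?thesis using ln_eq by (simp add: add.commute)
  qed
  have "(\<integral>\<^sup>+t. ennreal (1 / (\<bar>t\<bar> + 1 / N)) * indicator {-pi<..pi} t \<partial>lborel)
     \<le> (\<integral>\<^sup>+t. ennreal (1 / (t + 1 / N)) * indicator {0..pi} t + ennreal (1 / (1 / N - t)) * indicator {-pi..0} t \<partial>lborel)"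
    by (intro nn_integral_mono) (auto simp: indicator_def add.commute)
  also have "\<dots> = ennreal (ln (1 + pi * N)) + ennreal (ln (1 + pi * N))"
    by (subst nn_integral_add) (auto simp: left right)
  also have "\<dots> = ennreal (2 * ln (1 + pi * N))"
    using N by (subst ennreal_plus[symmetric]) auto
  finally show ?thesis .
qed

lemma sum_cis_interval:
  assumes "a \<le> b + 1"
  shows "(cis t - 1) * (\<Sum>v\<in>{a..b}. cis (of_int v * t)) = cis (of_int b * t) * cis t - cis (of_int a * t)"
proof -
  have "a - 1 \<le> b" using assms by simp
  then show ?thesis
  proof (induction b rule: int_ge_induct)
    case base
    have "cis (of_int (a - 1) * t) * cis t = cis (of_int a * t)"
      by (simp add: cis_mult algebra_simps)
    then show ?case by simp
  next
    case (step b)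
    have "{a..b + 1} = insert (b + 1) {a..b}" using step.hyps by auto
    then have "(cis t - 1) * (\<Sum>v\<in>{a..b + 1}. cis (of_int v * t))
      = (cis t - 1) * cis (of_int (b + 1) * t) + (cis t - 1) * (\<Sum>v\<in>{a..b}. cis (of_int v * t))"
      by (simp add: distrib_left)
    moreover have "cis (of_int b * t) * cis t = cis (of_int (b + 1) * t)"
      by (simp add: cis_mult algebra_simps)
    ultimately have "(cis t - 1) * (\<Sum>v\<in>{a..b + 1}. cis (of_int v * t))
      = (cis t - 1) * cis (of_int (b + 1) * t) + (cis (of_int (b + 1) * t) - cis (of_int a * t))"
      using step.IH by simp
    then show ?case by (simp only: left_diff_distrib mult_1) (simp only: mult.commute diff_add_eq add_diff_eq, simp)
  qed
qed

text \<open>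
  Summing the geometric series over an interval with affine end points leaves two exponentials with
  rounded affine exponents, divided by $e^{it} - 1$. The division costs $\pi/(2|t|)$ and each
  exponential $1 + O(|t| \log(N+1))$, so the total is $O(1/|t| + \log(N+1))$.
\<close>

lemma torus_norm_interval_sums:
  fixes N t :: real
  assumes J: "finite J" and N: "1 \<le> N" and n: "\<And>j. j \<in> J \<Longrightarrow> n j \<le> N" and t: "t \<noteq> 0" "\<bar>t\<bar> \<le> pi"
    and le: "\<And>k. k \<in> \<kappa> \<Longrightarrow> aff J lo k \<le> aff J up k"
  shows "torus_norm J (int_box J n)
      (\<lambda>k. of_bool (k \<in> \<kappa>) * (\<Sum>v\<in>{\<lceil>aff J lo k\<rceil>..\<lfloor>aff J up k\<rfloor>}. cis (of_int v * t)))
    \<le> ennreal (pi * (1 / \<bar>t\<bar> + (1 + (2 ^ (card J + 2) + card J) * ln (N + 1))))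
        * torus_norm J (int_box J n) (\<lambda>k. of_bool (k \<in> \<kappa>))"
proof -
  define D where "D = 1 + \<bar>t\<bar> * (1 + (2 ^ (card J + 2) + card J) * ln (N + 1))"
  define X where "X = torus_norm J (int_box J n) (\<lambda>k. of_bool (k \<in> \<kappa>))"
  define z where "z = cis t - 1"
  have z: "2 * \<bar>t\<bar> / pi \<le> cmod z" unfolding z_def using t(2) by (rule cmod_cis_minus_1_ge)
  then have z0: "z \<noteq> 0" "0 < cmod z" using t by (auto simp: divide_le_0_iff)
  have D0: "0 \<le> D" using N by (simp add: D_def)
  \<comment> \<open>A rounded-up lower end point is minus a rounded-down one, with $-t$ in place of $t$.\<close>
  define lo' where "lo' = (\<lambda>j. - fst lo j, - snd lo)"
  have lo': "aff J lo' k = - aff J lo k" for k by (simp add: lo'_def aff_def sum_negf)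
  have eq: "of_bool (k \<in> \<kappa>) * (\<Sum>v\<in>{\<lceil>aff J lo k\<rceil>..\<lfloor>aff J up k\<rfloor>}. cis (of_int v * t))
     = (cis t / z) * (of_bool (k \<in> \<kappa>) * cis (of_int \<lfloor>aff J up k\<rfloor> * t))
       + (- 1 / z) * (of_bool (k \<in> \<kappa>) * cis (of_int \<lfloor>aff J lo' k\<rfloor> * (- t)))" for k
  proof (cases "k \<in> \<kappa>")
    case True
    have "\<lceil>aff J lo k\<rceil> \<le> \<lfloor>aff J up k\<rfloor> + 1" using le[OF True] by linarith
    from sum_cis_interval[OF this, of t]
    have "(\<Sum>v\<in>{\<lceil>aff J lo k\<rceil>..\<lfloor>aff J up k\<rfloor>}. cis (of_int v * t))
        = (cis (of_int \<lfloor>aff J up k\<rfloor> * t) * cis t - cis (of_int \<lceil>aff J lo k\<rceil> * t)) / z"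
      using z0 by (simp add: z_def[symmetric] field_simps)
    moreover have "of_int \<lfloor>aff J lo' k\<rfloor> * (- t) = of_int \<lceil>aff J lo k\<rceil> * t"
      by (simp add: lo' ceiling_def)
    ultimately show ?thesis using True by (simp add: diff_divide_distrib)
  qed simp
  have F: "{0..\<lfloor>n j\<rfloor>} \<subseteq> {0..\<lfloor>N\<rfloor>}" if "j \<in> J" for j using floor_mono[OF n[OF that]] by auto
  have mod: "torus_norm J (int_box J n) (\<lambda>k. of_bool (k \<in> \<kappa>) * cis (of_int \<lfloor>aff J f k\<rfloor> * s)) \<le> ennreal D * X"
    if "s = t \<or> s = - t" for f s
    using torus_norm_floor_modulation[OF J N F, where t = s and \<phi> = "\<lambda>k. of_bool (k \<in> \<kappa>)" and w = "fst f" and r = "snd f"] that t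
    unfolding D_def X_def aff_def int_box_def by auto
  have "torus_norm J (int_box J n)
      (\<lambda>k. of_bool (k \<in> \<kappa>) * (\<Sum>v\<in>{\<lceil>aff J lo k\<rceil>..\<lfloor>aff J up k\<rfloor>}. cis (of_int v * t)))
    \<le> ennreal (cmod (cis t / z)) * torus_norm J (int_box J n) (\<lambda>k. of_bool (k \<in> \<kappa>) * cis (of_int \<lfloor>aff J up k\<rfloor> * t))
      + ennreal (cmod (- 1 / z)) * torus_norm J (int_box J n) (\<lambda>k. of_bool (k \<in> \<kappa>) * cis (of_int \<lfloor>aff J lo' k\<rfloor> * (- t)))"
    unfolding eq torus_norm_cmult[OF J, symmetric] by (rule torus_norm_add_le[OF J])
  also have "\<dots> \<le> ennreal (cmod (cis t / z)) * (ennreal D * X) + ennreal (cmod (- 1 / z)) * (ennreal D * X)"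
    by (intro add_mono mult_left_mono mod) auto
  also have "\<dots> = ennreal (2 / cmod z * D) * X"
    using D0 by (simp add: norm_divide distrib_right[symmetric] mult.assoc[symmetric]
         ennreal_mult'[symmetric] ennreal_plus[symmetric] del: ennreal_plus)
  also have "\<dots> \<le> ennreal (pi / \<bar>t\<bar> * D) * X"
  proof (intro mult_right_mono ennreal_leI)
    have "2 / cmod z \<le> 2 / (2 * \<bar>t\<bar> / pi)" using z z0 t by (intro divide_left_mono) auto
    then show "2 / cmod z \<le> pi / \<bar>t\<bar>" using t by simp
  qed (use D0 in auto)
  also have "pi / \<bar>t\<bar> * D = pi * (1 / \<bar>t\<bar> + (1 + (2 ^ (card J + 2) + card J) * ln (N + 1)))"
    using t by (simp add: D_def field_simps)
  finally show ?thesis by (simp only: X_def)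
qed

lemma ln_add_1_bounds:
  assumes "1 \<le> (N::real)"
  shows "1 \<le> 2 * ln (N + 1)" "ln (1 + pi * N) \<le> 4 * ln (N + 1)"
proof -
  have "exp (1/2 :: real) \<le> 2"
  proof -
    have "exp (1/2 :: real) ^ 2 = exp 1" by (simp add: exp_double[symmetric])
    also have "\<dots> \<le> 2 ^ 2" using exp_le by simp
    finally show ?thesis by (rule power2_le_imp_le) simp
  qed
  also have "2 \<le> N + 1" using assms by simp
  finally have "1 / 2 \<le> ln (N + 1)" using assms by (subst ln_ge_iff) auto
  then show "1 \<le> 2 * ln (N + 1)" by simp
  have "1 + pi * N \<le> 1 + real 4 * N" using pi_less_4 assms by (intro add_left_mono mult_right_mono) auto
  also have "\<dots> \<le> (1 + N) ^ 4" using assms by (intro Bernoulli_inequality) auto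
  finally have "ln (1 + pi * N) \<le> ln ((1 + N) ^ 4)" using assms by (subst ln_le_cancel_iff) (auto simp: add_pos_nonneg)
  also have "\<dots> = 4 * ln (N + 1)" using assms by (simp add: ln_realpow add.commute)
  finally show "ln (1 + pi * N) \<le> 4 * ln (N + 1)" .
qed

text \<open>
  Splitting off a coordinate $j$ of largest side $N = n_j$. For fixed $t = x_j$ the norm in the
  remaining coordinates is bounded in two ways: trivially by $N + 1$ slices, and through the
  interval decomposition by $O(1/|t| + \log(N+1))$. Together they give
  $O(1/(|t| + 1/N) + \log(N+1))$, whose integral over $(-\pi,\pi]$ is $O(\log(N+1))$.
\<close>

lemma torus_norm_cell_step:
  assumes J: "finite J" "j \<notin> J" and nj: "1 \<le> n j" and max: "\<And>i. i \<in> J \<Longrightarrow> n i \<le> n j"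
    and X: "0 \<le> X"
    and IH: "\<And>K'. cell J n (5 * m + 5) K' \<Longrightarrow> torus_norm J (int_box J n) (\<lambda>k. of_bool (k \<in> K')) \<le> ennreal X"
    and K: "cell (insert j J) n m K"
  shows "torus_norm (insert j J) (int_box (insert j J) n) (\<lambda>k. of_bool (k \<in> K))
    \<le> ennreal (pi * (m + 1)\<^sup>2 * (32 + 2 * pi * (2 + (2 ^ (card J + 2) + card J))) * ln (n j + 1) * X)"
proof -
  define N where "N = n j"
  have N: "1 \<le> N" using nj by (simp add: N_def)
  define E where "E = 1 + (2 ^ (card J + 2) + card J) * ln (N + 1)"
  have E: "1 \<le> E" using N by (simp add: E_def)
  define p where "p = real ((m + 1)\<^sup>2)"
  have p: "1 \<le> p" by (simp add: p_def)
  define g where "g = (\<lambda>t. torus_norm J (int_box J n) (\<lambda>k. \<Sum>v\<in>{0..\<lfloor>n j\<rfloor>}. of_bool (k(j := v) \<in> K) * cis (of_int v * t)))"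
  have small: "g t \<le> ennreal ((N + 1) * X)" for t
  proof -
    have "g t \<le> (\<Sum>v\<in>{0..\<lfloor>n j\<rfloor>}. torus_norm J (int_box J n) (\<lambda>k. of_bool (k(j := v) \<in> K) * cis (of_int v * t)))"
      unfolding g_def by (rule torus_norm_sum_le) (use J in auto)
    also have "\<dots> \<le> (\<Sum>v\<in>{0..\<lfloor>n j\<rfloor>}. ennreal X)"
    proof (rule sum_mono)
      fix v assume v: "v \<in> {0..\<lfloor>n j\<rfloor>}"
      have "torus_norm J (int_box J n) (\<lambda>k. of_bool (k(j := v) \<in> K) * cis (of_int v * t))
        = torus_norm J (int_box J n) (\<lambda>k. cis (of_int v * t) * of_bool (k \<in> {k \<in> int_box J n. k(j := v) \<in> K}))"
        by (rule torus_norm_cong) simp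
      also have "\<dots> = torus_norm J (int_box J n) (\<lambda>k. of_bool (k \<in> {k \<in> int_box J n. k(j := v) \<in> K}))"
        unfolding torus_norm_cmult[OF J(1)] by simp
      also have "\<dots> \<le> ennreal X"
        by (rule IH, rule cell_mono[OF cell_slice[OF J K v]]) simp
      finally show "torus_norm J (int_box J n) (\<lambda>k. of_bool (k(j := v) \<in> K) * cis (of_int v * t)) \<le> ennreal X" .
    qed
    also have "\<dots> = ennreal (real (card {0..\<lfloor>n j\<rfloor>}) * X)"
      by (simp add: ennreal_mult' ennreal_of_nat_eq_real_of_nat)
    also have "\<dots> \<le> ennreal ((N + 1) * X)"
    proof (intro ennreal_leI mult_right_mono X)
      have "0 \<le> \<lfloor>n j\<rfloor>" using nj by simp
      then show "real (card {0..\<lfloor>n j\<rfloor>}) \<le> N + 1" by (simp add: N_def)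
    qed
    finally show ?thesis .
  qed
  obtain I :: "(nat \<times> nat) set" and \<kappa> lo up where
    I: "finite I" "card I \<le> (m + 1)\<^sup>2" and
    \<kappa>: "\<And>i. i \<in> I \<Longrightarrow> cell J n (5 * m + 5) (\<kappa> i)" and
    le: "\<And>i k. i \<in> I \<Longrightarrow> k \<in> \<kappa> i \<Longrightarrow> aff J (lo i) k \<le> aff J (up i) k" and
    split: "\<And>k (g :: int \<Rightarrow> complex). k \<in> int_box J n \<Longrightarrow>
      (\<Sum>v\<in>{0..\<lfloor>n j\<rfloor>}. of_bool (k(j := v) \<in> K) * g v)
        = (\<Sum>i\<in>I. of_bool (k \<in> \<kappa> i) * (\<Sum>v\<in>{\<lceil>aff J (lo i) k\<rceil>..\<lfloor>aff J (up i) k\<rfloor>}. g v))"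
    using cell_fibre_decomposition[OF J K] by blast
  have large: "g t \<le> ennreal (p * (pi * (1 / \<bar>t\<bar> + E)) * X)" if t: "t \<noteq> 0" "\<bar>t\<bar> \<le> pi" for t
  proof -
    have "g t = torus_norm J (int_box J n) (\<lambda>k. \<Sum>i\<in>I. of_bool (k \<in> \<kappa> i) *
        (\<Sum>v\<in>{\<lceil>aff J (lo i) k\<rceil>..\<lfloor>aff J (up i) k\<rfloor>}. cis (of_int v * t)))"
      unfolding g_def by (rule torus_norm_cong) (rule split)
    also have "\<dots> \<le> (\<Sum>i\<in>I. torus_norm J (int_box J n) (\<lambda>k. of_bool (k \<in> \<kappa> i) *
        (\<Sum>v\<in>{\<lceil>aff J (lo i) k\<rceil>..\<lfloor>aff J (up i) k\<rfloor>}. cis (of_int v * t))))"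
      by (rule torus_norm_sum_le[OF J(1) I(1)])
    also have "\<dots> \<le> (\<Sum>i\<in>I. ennreal (pi * (1 / \<bar>t\<bar> + E)) * ennreal X)"
    proof (rule sum_mono)
      fix i assume i: "i \<in> I"
      have "torus_norm J (int_box J n) (\<lambda>k. of_bool (k \<in> \<kappa> i) *
        (\<Sum>v\<in>{\<lceil>aff J (lo i) k\<rceil>..\<lfloor>aff J (up i) k\<rfloor>}. cis (of_int v * t)))
        \<le> ennreal (pi * (1 / \<bar>t\<bar> + E)) * torus_norm J (int_box J n) (\<lambda>k. of_bool (k \<in> \<kappa> i))"
        unfolding E_def
        by (rule torus_norm_interval_sums[OF J(1) N _ t le[OF i]]) (use max in \<open>auto simp: N_def\<close>)
      also have "\<dots> \<le> ennreal (pi * (1 / \<bar>t\<bar> + E)) * ennreal X"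
        by (intro mult_left_mono IH \<kappa> i) simp
      finally show "torus_norm J (int_box J n) (\<lambda>k. of_bool (k \<in> \<kappa> i) *
        (\<Sum>v\<in>{\<lceil>aff J (lo i) k\<rceil>..\<lfloor>aff J (up i) k\<rfloor>}. cis (of_int v * t)))
        \<le> ennreal (pi * (1 / \<bar>t\<bar> + E)) * ennreal X" .
    qed
    also have "\<dots> = ennreal (real (card I) * (pi * (1 / \<bar>t\<bar> + E)) * X)"
      using E X by (simp add: ennreal_mult ennreal_of_nat_eq_real_of_nat mult.assoc)
    also have "\<dots> \<le> ennreal (p * (pi * (1 / \<bar>t\<bar> + E)) * X)"
      using I(2) E X unfolding p_def by (intro ennreal_leI mult_right_mono) (auto simp only: of_nat_le_iff, auto)
    finally show ?thesis .
  qed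
  have pp: "1 \<le> pi * p" using p pi_gt3 by (smt (verit) mult_le_cancel_left1)
  have g_le: "g t \<le> ennreal (pi * p * X) * (ennreal 4 * ennreal (1 / (\<bar>t\<bar> + 1 / N)) + ennreal E)"
    if t: "\<bar>t\<bar> \<le> pi" for t
  proof -
    have pos: "0 < 1 / (\<bar>t\<bar> + 1 / N)" using N by (simp add: add_nonneg_pos)
    have "g t \<le> ennreal (pi * p * X * (4 * (1 / (\<bar>t\<bar> + 1 / N)) + E))"
    proof (cases "\<bar>t\<bar> \<le> 1 / N")
      case True
      have "N / 2 = 1 / (1 / N + 1 / N)" by simp
      also have "\<dots> \<le> 1 / (\<bar>t\<bar> + 1 / N)" using True N by (intro divide_left_mono) (auto simp: add_nonneg_pos)
      finally have "N + 1 \<le> 4 * (1 / (\<bar>t\<bar> + 1 / N)) + E" using N E by simp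
      then have "(N + 1) * X \<le> (4 * (1 / (\<bar>t\<bar> + 1 / N)) + E) * X" using X by (rule mult_right_mono)
      also have "\<dots> \<le> pi * p * ((4 * (1 / (\<bar>t\<bar> + 1 / N)) + E) * X)"
      proof -
        have "0 \<le> (4 * (1 / (\<bar>t\<bar> + 1 / N)) + E) * X" using pos E X by (intro mult_nonneg_nonneg) auto
        from mult_right_mono[OF pp this] show ?thesis by (simp only: mult_1)
      qed
      finally have "(N + 1) * X \<le> pi * p * X * (4 * (1 / (\<bar>t\<bar> + 1 / N)) + E)" by (simp add: mult_ac)
      then show ?thesis using small[of t] ennreal_leI order.trans by blast
    next
      case False
      then have t0: "t \<noteq> 0" "0 < \<bar>t\<bar>" using N by auto
      have "1 / \<bar>t\<bar> = 2 / (\<bar>t\<bar> + \<bar>t\<bar>)" by simp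
      also have "\<dots> \<le> 2 / (\<bar>t\<bar> + 1 / N)" using False t0 N by (intro divide_left_mono) (auto simp: add_nonneg_pos)
      also have "\<dots> = 2 * (1 / (\<bar>t\<bar> + 1 / N))" by simp
      also have "\<dots> \<le> 4 * (1 / (\<bar>t\<bar> + 1 / N))" using pos by (intro mult_right_mono) auto
      finally have "p * (pi * (1 / \<bar>t\<bar> + E)) * X \<le> p * (pi * (4 * (1 / (\<bar>t\<bar> + 1 / N)) + E)) * X"
        using p X by (intro mult_right_mono mult_left_mono add_right_mono) auto
      then have "p * (pi * (1 / \<bar>t\<bar> + E)) * X \<le> pi * p * X * (4 * (1 / (\<bar>t\<bar> + 1 / N)) + E)"
        by (simp only: mult_ac)
      then show ?thesis using large[OF t0(1) t] ennreal_leI order.trans by blast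
    qed
    also have "\<dots> = ennreal (pi * p * X) * (ennreal 4 * ennreal (1 / (\<bar>t\<bar> + 1 / N)) + ennreal E)"
    proof -
      have "ennreal (c * (4 * x + E)) = ennreal c * (ennreal 4 * ennreal x + ennreal E)" if "0 \<le> c" "0 \<le> x" for c x
        using that E by (simp add: ennreal_mult ennreal_plus)
      note distribute = this
      show ?thesis by (rule distribute) (use pos X p in auto)
    qed
    finally show ?thesis .
  qed
  have "torus_norm (insert j J) (int_box (insert j J) n) (\<lambda>k. of_bool (k \<in> K))
     = (\<integral>\<^sup>+t. g t * indicator {-pi<..pi} t \<partial>lborel)"
    unfolding g_def int_box_def by (rule torus_norm_insert[OF J])
  also have "\<dots> \<le> (\<integral>\<^sup>+t. ennreal (pi * p * X) * (ennreal 4 * (ennreal (1 / (\<bar>t\<bar> + 1 / N)) * indicator {-pi<..pi} t)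
      + ennreal E * indicator {-pi<..pi} t) \<partial>lborel)"
    using g_le by (intro nn_integral_mono) (auto simp: indicator_def)
  also have "\<dots> = ennreal (pi * p * X) * (ennreal 4 * (\<integral>\<^sup>+t. ennreal (1 / (\<bar>t\<bar> + 1 / N)) * indicator {-pi<..pi} t \<partial>lborel)
      + ennreal E * ennreal (2 * pi))"
    by (simp add: nn_integral_cmult nn_integral_add nn_integral_cmult_indicator)
  also have "\<dots> \<le> ennreal (pi * p * X) * (ennreal 4 * ennreal (2 * ln (1 + pi * N)) + ennreal E * ennreal (2 * pi))"
    by (intro mult_left_mono add_right_mono nn_integral_log_kernel N) auto
  also have "\<dots> = ennreal (pi * p * X * (8 * ln (1 + pi * N) + 2 * pi * E))"
    using N E X p by (simp add: ennreal_mult ennreal_plus mult_ac)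
  also have "\<dots> \<le> ennreal (pi * p * X * ((32 + 2 * pi * (2 + (2 ^ (card J + 2) + card J))) * ln (N + 1)))"
  proof (intro ennreal_leI mult_left_mono)
    have "E \<le> (2 + (2 ^ (card J + 2) + card J)) * ln (N + 1)"
      using ln_add_1_bounds(1)[OF N] by (simp add: E_def distrib_right)
    then have h: "2 * pi * E \<le> 2 * pi * ((2 + (2 ^ (card J + 2) + card J)) * ln (N + 1))"
      by (rule mult_left_mono) simp
    have split: "(32 + 2 * pi * c) * l = 32 * l + 2 * pi * (c * l)" for c l :: real
      by (simp add: distrib_right mult.assoc)
    show "8 * ln (1 + pi * N) + 2 * pi * E \<le> (32 + 2 * pi * (2 + (2 ^ (card J + 2) + card J))) * ln (N + 1)"
      unfolding split by (rule add_mono[OF _ h]) (use ln_add_1_bounds(2)[OF N] in linarith)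
  qed (use X p in simp)
  finally show ?thesis by (simp add: p_def N_def mult_ac)
qed

text \<open>
  The constant depends only on the dimension $D$ and the number $m$ of half-spaces. It is chosen
  before the index set, the box and the cell, since all of them change in the induction; the number
  of half-spaces grows from $m$ to $5m + 5$ with each coordinate that is eliminated.
\<close>

theorem torus_norm_cell:
  "\<exists>C>0. \<forall>(J :: 'i set) n K. finite J \<and> card J = D \<and> (\<forall>j\<in>J. 1 \<le> n j) \<and> cell J n m K \<longrightarrow>
     torus_norm J (int_box J n) (\<lambda>k. of_bool (k \<in> K)) \<le> ennreal (C * (\<Prod>j\<in>J. ln (n j + 1)))"
proof (induction D arbitrary: m)
  case 0
  show ?case
  proof (intro exI[of _ 1] conjI allI impI)
    fix J :: "'i set" and n :: "'i \<Rightarrow> real" and K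
    assume "finite J \<and> card J = 0 \<and> (\<forall>j\<in>J. 1 \<le> n j) \<and> cell J n m K"
    then have "J = {}" by (auto simp: card_eq_0_iff)
    have "card ({a} \<inter> S) \<le> Suc 0" for a :: "'i \<Rightarrow> int" and S
      using card_mono[of "{a}" "{a} \<inter> S"] by simp
    with \<open>J = {}\<close> show "torus_norm J (int_box J n) (\<lambda>k. of_bool (k \<in> K)) \<le> ennreal (1 * (\<Prod>j\<in>J. ln (n j + 1)))"
      by (simp add: torus_norm_def int_box_def PiM_empty nn_integral_count_space_finite)
  qed simp
next
  case (Suc D)
  obtain C where C: "0 < C" and bound: "\<And>(J :: 'i set) n K. finite J \<Longrightarrow> card J = D \<Longrightarrow> \<forall>j\<in>J. 1 \<le> n j \<Longrightarrow>
      cell J n (5 * m + 5) K \<Longrightarrow>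
      torus_norm J (int_box J n) (\<lambda>k. of_bool (k \<in> K)) \<le> ennreal (C * (\<Prod>j\<in>J. ln (n j + 1)))"
    using Suc.IH[of "5 * m + 5"] by blast
  define c where "c = pi * (m + 1)\<^sup>2 * (32 + 2 * pi * (2 + (2 ^ (D + 2) + D)))"
  have c: "0 < c" unfolding c_def by (intro mult_pos_pos add_pos_nonneg) auto
  show ?case
  proof (intro exI[of _ "c * C"] conjI allI impI)
    show "0 < c * C" using c C by simp
    fix J :: "'i set" and n :: "'i \<Rightarrow> real" and K
    assume *: "finite J \<and> card J = Suc D \<and> (\<forall>j\<in>J. 1 \<le> n j) \<and> cell J n m K"
    have "Max (n ` J) \<in> n ` J" using * by (intro Max_in) auto
    then obtain j where j: "j \<in> J" "n j = Max (n ` J)" by auto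
    define J' where "J' = J - {j}"
    have J: "J = insert j J'" "finite J'" "j \<notin> J'" "card J' = D" using * j by (auto simp: J'_def)
    have max: "n i \<le> n j" if "i \<in> J'" for i using * that j by (auto simp: J'_def)
    have ge1: "\<forall>i\<in>J'. 1 \<le> n i" using * by (auto simp: J'_def)
    have P: "0 \<le> C * (\<Prod>i\<in>J'. ln (n i + 1))" using C ge1 by (intro mult_nonneg_nonneg prod_nonneg) force+
    have "torus_norm (insert j J') (int_box (insert j J') n) (\<lambda>k. of_bool (k \<in> K))
      \<le> ennreal (pi * (m + 1)\<^sup>2 * (32 + 2 * pi * (2 + (2 ^ (card J' + 2) + card J'))) * ln (n j + 1)
          * (C * (\<Prod>i\<in>J'. ln (n i + 1))))"
    proof (rule torus_norm_cell_step[OF J(2,3) _ max P bound[OF J(2,4) ge1]])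
      show "1 \<le> n j" using * j by auto
      show "cell (insert j J') n m K" using * J(1) by simp
    qed
    also have "pi * (m + 1)\<^sup>2 * (32 + 2 * pi * (2 + (2 ^ (card J' + 2) + card J'))) * ln (n j + 1)
          * (C * (\<Prod>i\<in>J'. ln (n i + 1))) = c * C * (\<Prod>i\<in>insert j J'. ln (n i + 1))"
      using J by (simp add: c_def mult_ac)
    finally show "torus_norm J (int_box J n) (\<lambda>k. of_bool (k \<in> K)) \<le> ennreal (c * C * (\<Prod>j\<in>J. ln (n j + 1)))"
      unfolding J(1)[symmetric] .
  qed
qed

section \<open>Triangulated polyhedra\<close>

text \<open>
  The coordinate functions of a set of affinely independent points.
\<close>

lemma affine_functional_exists:
  fixes B :: "'a::euclidean_space set"
  assumes B: "\<not> affine_dependent B" and b: "b \<in> B"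
  shows "\<exists>w r. \<forall>b'\<in>B. w \<bullet> b' + r = (if b' = b then 1 else 0 :: real)"
proof -
  have ind: "independent ((\<lambda>x. - b + x) ` (B - {b}))"
    using B affine_dependent_iff_dependent2[OF b] by simp
  obtain f :: "'a \<Rightarrow> real" where f: "linear f" "\<And>x. x \<in> (\<lambda>x. - b + x) ` (B - {b}) \<Longrightarrow> f x = - 1"
    using linear_independent_extend[OF ind, of "\<lambda>_. - 1"] by blast
  define w where "w = (\<Sum>i\<in>Basis. f i *\<^sub>R i)"
  have w: "w \<bullet> x = f x" for x
  proof -
    have "f x = f (\<Sum>i\<in>Basis. (x \<bullet> i) *\<^sub>R i)" by (simp add: euclidean_representation)
    also have "\<dots> = (\<Sum>i\<in>Basis. (x \<bullet> i) * f i)"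
      using f(1) by (simp add: linear_sum linear_scale)
    also have "\<dots> = w \<bullet> x" unfolding w_def inner_sum_left by (simp add: inner_commute mult.commute)
    finally show ?thesis by simp
  qed
  have "w \<bullet> b' + (1 - f b) = (if b' = b then 1 else 0)" if b': "b' \<in> B" for b'
  proof (cases "b' = b")
    case False
    then have "f (- b + b') = - 1" using b' by (intro f(2)) auto
    then show ?thesis using f(1) False by (simp add: w linear_diff)
  qed (simp add: w)
  then show ?thesis by blast
qed

text \<open>
  All faces of a simplex are described by the same $d + 1$ affine functions, namely the barycentric
  coordinates of an affine basis that contains the vertices. Extending the vertices to a basis
  handles simplices of lower dimension on the same footing.
\<close>

lemma barycentric_coordinates:
  fixes C :: "'a::euclidean_space set"
  assumes C: "\<not> affine_dependent C"
  shows "\<exists>B w r. finite B \<and> card B \<le> DIM('a) + 1 \<and> C \<subseteq> B \<and>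
    (\<forall>C'\<subseteq>C. convex hull C' =
      {x. (\<forall>b\<in>B. 0 \<le> w b \<bullet> x + r b) \<and> (\<forall>b\<in>B - C'. w b \<bullet> x + (r b :: real) = 0)})"
proof -
  obtain B where B: "\<not> affine_dependent B" "C \<subseteq> B" "affine hull B = UNIV"
    using extend_to_affine_basis[OF C subset_UNIV] by (metis hull_UNIV)
  have fin: "finite B" using B(1) by (rule aff_independent_finite)
  have card: "card B \<le> DIM('a) + 1"
    using independent_card_le_aff_dim[OF subset_UNIV B(1)] by simp
  have "\<forall>b\<in>B. \<exists>w r. \<forall>b'\<in>B. w \<bullet> b' + r = (if b' = b then 1 else 0 :: real)"
    using affine_functional_exists[OF B(1)] by blast
  then obtain w r where wr: "\<And>b b'. b \<in> B \<Longrightarrow> b' \<in> B \<Longrightarrow> w b \<bullet> b' + r b = (if b' = b then 1 else 0 :: real)"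
    by metis
  have coord: "w b \<bullet> (\<Sum>c\<in>B. u c *\<^sub>R c) + r b = u b" if "sum u B = 1" "b \<in> B" for u b
  proof -
    have "w b \<bullet> (\<Sum>c\<in>B. u c *\<^sub>R c) + r b = (\<Sum>c\<in>B. u c * (w b \<bullet> c)) + sum u B * r b"
      using that by (simp add: inner_sum_right)
    also have "\<dots> = (\<Sum>c\<in>B. u c * (w b \<bullet> c + r b))"
      by (simp add: sum_distrib_right sum.distrib distrib_left)
    also have "\<dots> = (\<Sum>c\<in>B. if c = b then u c else 0)"
      using wr that by (intro sum.cong) auto
    finally show ?thesis using fin that by simp
  qed
  have hull: "convex hull C' = {x. (\<forall>b\<in>B. 0 \<le> w b \<bullet> x + r b) \<and> (\<forall>b\<in>B - C'. w b \<bullet> x + r b = 0)}"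
    if C': "C' \<subseteq> C" for C'
  proof (intro set_eqI iffI)
    have C'B: "C' \<subseteq> B" using C' B(2) by blast
    have finC': "finite C'" using C'B fin finite_subset by blast
    fix x
    {
      assume "x \<in> convex hull C'"
      then obtain u where u: "\<forall>c\<in>C'. 0 \<le> u c" "sum u C' = 1" "(\<Sum>c\<in>C'. u c *\<^sub>R c) = x"
        unfolding convex_hull_finite[OF finC'] by auto
      define v where "v = (\<lambda>c. if c \<in> C' then u c else 0)"
      have v: "sum v B = 1" "(\<Sum>c\<in>B. v c *\<^sub>R c) = x"
        using sum.mono_neutral_left[OF fin C'B, of v] sum.mono_neutral_left[OF fin C'B, of "\<lambda>c. v c *\<^sub>R c"] u
        by (auto simp: v_def cong: sum.cong)
      show "x \<in> {x. (\<forall>b\<in>B. 0 \<le> w b \<bullet> x + r b) \<and> (\<forall>b\<in>B - C'. w b \<bullet> x + r b = 0)}"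
        using coord[OF v(1)] u(1) unfolding v(2) by (auto simp: v_def)
    next
      assume x: "x \<in> {x. (\<forall>b\<in>B. 0 \<le> w b \<bullet> x + r b) \<and> (\<forall>b\<in>B - C'. w b \<bullet> x + r b = 0)}"
      have "x \<in> affine hull B" using B(3) by simp
      then obtain u where u: "sum u B = 1" "(\<Sum>c\<in>B. u c *\<^sub>R c) = x"
        unfolding affine_hull_finite[OF fin] by auto
      have uc: "w b \<bullet> x + r b = u b" if "b \<in> B" for b using coord[OF u(1) that] u(2) by simp
      have "sum u C' = 1" "(\<Sum>c\<in>C'. u c *\<^sub>R c) = x"
        using sum.mono_neutral_left[OF fin C'B, of u] sum.mono_neutral_left[OF fin C'B, of "\<lambda>c. u c *\<^sub>R c"] u x uc
        by auto
      moreover have "\<forall>c\<in>C'. 0 \<le> u c" using x uc C'B by auto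
      ultimately show "x \<in> convex hull C'" unfolding convex_hull_finite[OF finC'] by blast
    }
  qed
  show ?thesis
    using fin card B(2) hull by (intro exI[of _ B] exI[of _ w] exI[of _ r] conjI allI impI)
qed

text \<open>
  Integer points are indexed by the canonical basis of the space, because that is the index set of
  the product measure from which Lebesgue measure is built.
\<close>

definition lattice_vec :: "((real ^ 'd) \<Rightarrow> int) \<Rightarrow> real ^ 'd" where
  "lattice_vec k = (\<Sum>b\<in>Basis. of_int (k b) *\<^sub>R b)"

lemma lattice_vec_inner_Basis: "b \<in> Basis \<Longrightarrow> lattice_vec k \<bullet> b = of_int (k b)"
  by (simp add: lattice_vec_def)

lemma inner_lattice_vec: "w \<bullet> lattice_vec k = (\<Sum>b\<in>Basis. (w \<bullet> b) * of_int (k b))"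
  by (simp add: lattice_vec_def inner_sum_right mult.commute)

lemma all_Basis_vec: "(\<forall>b\<in>(Basis :: (real ^ 'd) set). Q (x \<bullet> b)) \<longleftrightarrow> (\<forall>j. Q (x $ j))"
  by (auto simp: Basis_vec_def cart_eq_inner_axis)

lemma prod_Basis_vec: "(\<Prod>b\<in>(Basis :: (real ^ 'd) set). g (x \<bullet> b)) = (\<Prod>j\<in>UNIV. g (x $ j))"
proof -
  have B: "(Basis :: (real ^ 'd) set) = (\<lambda>j. axis j 1) ` UNIV" by (auto simp: Basis_vec_def)
  have inj: "inj_on (\<lambda>j. axis j 1 :: real ^ 'd) UNIV" by (auto simp: inj_on_def axis_eq_axis)
  show ?thesis unfolding B prod.reindex[OF inj] by (simp add: cart_eq_inner_axis)
qed

lemma lebesgue_constant_le: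
  fixes W :: "(real ^ 'd) set"
  assumes W: "W \<subseteq> {x. \<forall>j. 0 \<le> x $ j \<and> x $ j \<le> n $ j}" and R: "0 \<le> R"
    and le: "torus_norm Basis (int_box Basis (\<lambda>b. n \<bullet> b)) (\<lambda>k. of_bool (lattice_vec k \<in> W)) \<le> ennreal R"
  shows "lebesgue_constant W \<le> R"
proof -
  define S :: "(real ^ 'd) set" where "S = {x. \<forall>j. - pi < x $ j \<and> x $ j \<le> pi}"
  define Z where "Z = {k \<in> W. \<forall>j. k $ j \<in> \<int>}"
  define \<Phi> where "\<Phi> = (\<lambda>x. cmod (\<Sum>k \<in> Z. exp (\<i> * complex_of_real (k \<bullet> x))))"
  define B where "B = int_box (Basis :: (real ^ 'd) set) (\<lambda>b. n \<bullet> b)"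
  have finB: "finite B" unfolding B_def by (rule finite_int_box) simp
  have bij: "bij_betw lattice_vec {k \<in> B. lattice_vec k \<in> W} Z"
  proof (rule bij_betw_byWitness[of _ "\<lambda>x. restrict (\<lambda>b. \<lfloor>x \<bullet> b\<rfloor>) Basis"])
    show "\<forall>k\<in>{k \<in> B. lattice_vec k \<in> W}. restrict (\<lambda>b. \<lfloor>lattice_vec k \<bullet> b\<rfloor>) Basis = k"
      by (auto simp: B_def int_box_def lattice_vec_inner_Basis PiE_iff extensional_def fun_eq_iff)
    have int: "of_int \<lfloor>x \<bullet> b\<rfloor> = x \<bullet> b" if "x \<in> Z" "b \<in> Basis" for x b
      using that all_Basis_vec[of "\<lambda>y. y \<in> \<int>" x] by (auto simp: Z_def)
    show *: "\<forall>x\<in>Z. lattice_vec (restrict (\<lambda>b. \<lfloor>x \<bullet> b\<rfloor>) Basis) = x"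
      by (auto simp: lattice_vec_def int euclidean_representation)
    show "lattice_vec ` {k \<in> B. lattice_vec k \<in> W} \<subseteq> Z"
    proof clarify
      fix k assume "lattice_vec k \<in> W"
      moreover have "\<forall>j. lattice_vec k $ j \<in> \<int>"
        unfolding all_Basis_vec[symmetric, of "\<lambda>y. y \<in> \<int>"] by (simp add: lattice_vec_inner_Basis)
      ultimately show "lattice_vec k \<in> Z" by (simp add: Z_def)
    qed
    show "(\<lambda>x. restrict (\<lambda>b. \<lfloor>x \<bullet> b\<rfloor>) Basis) ` Z \<subseteq> {k \<in> B. lattice_vec k \<in> W}"
    proof clarify
      fix x assume x: "x \<in> Z"
      have "0 \<le> x \<bullet> b \<and> x \<bullet> b \<le> n \<bullet> b" if b: "b \<in> Basis" for b
      proof -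
        obtain j where "b = axis j 1" using b by (auto simp: Basis_vec_def)
        then show ?thesis using W x by (auto simp: Z_def cart_eq_inner_axis)
      qed
      then have "restrict (\<lambda>b. \<lfloor>x \<bullet> b\<rfloor>) Basis \<in> B"
        by (simp add: B_def int_box_def PiE_iff floor_mono)
      then show "restrict (\<lambda>b. \<lfloor>x \<bullet> b\<rfloor>) Basis \<in> B \<and> lattice_vec (restrict (\<lambda>b. \<lfloor>x \<bullet> b\<rfloor>) Basis) \<in> W"
        using * x by (simp add: Z_def)
    qed
  qed
  have \<Phi>_eq: "\<Phi> (\<Sum>b\<in>Basis. y b *\<^sub>R b)
      = cmod (\<Sum>k\<in>B. of_bool (lattice_vec k \<in> W) * cis (\<Sum>b\<in>Basis. of_int (k b) * y b))" for y
  proof -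
    have "(\<Sum>k\<in>Z. exp (\<i> * complex_of_real (k \<bullet> (\<Sum>b\<in>Basis. y b *\<^sub>R b))))
       = (\<Sum>k\<in>{k \<in> B. lattice_vec k \<in> W}. exp (\<i> * complex_of_real (lattice_vec k \<bullet> (\<Sum>b\<in>Basis. y b *\<^sub>R b))))"
      by (rule sum.reindex_bij_betw[OF bij, symmetric])
    also have "\<dots> = (\<Sum>k\<in>{k \<in> B. lattice_vec k \<in> W}. cis (\<Sum>b\<in>Basis. of_int (k b) * y b))"
      by (intro sum.cong refl) (simp add: cis_conv_exp inner_sum_right lattice_vec_inner_Basis mult.commute)
    also have "\<dots> = (\<Sum>k\<in>B. if lattice_vec k \<in> W then cis (\<Sum>b\<in>Basis. of_int (k b) * y b) else 0)"
      using finB by (simp add: sum.inter_filter)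
    also have "\<dots> = (\<Sum>k\<in>B. of_bool (lattice_vec k \<in> W) * cis (\<Sum>b\<in>Basis. of_int (k b) * y b))"
      by (intro sum.cong) auto
    finally show ?thesis by (simp add: \<Phi>_def)
  qed
  have ind_eq: "indicator S (\<Sum>b\<in>Basis. y b *\<^sub>R b) = (\<Prod>b\<in>Basis. indicator {-pi<..pi} (y b) :: ennreal)" for y
  proof -
    have "(\<Sum>b\<in>Basis. y b *\<^sub>R b) \<in> S \<longleftrightarrow> (\<forall>b\<in>Basis. - pi < y b \<and> y b \<le> pi)"
      unfolding S_def mem_Collect_eq all_Basis_vec[symmetric, of "\<lambda>z. - pi < z \<and> z \<le> pi"] by simp
    then show ?thesis by (auto simp: indicator_def prod_zero_iff)
  qed
  have meas: "(\<lambda>x. ennreal (\<Phi> x) * indicator S x) \<in> borel_measurable borel"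
  proof -
    have "S = (\<Inter>j\<in>UNIV. {x. - pi < x $ j} \<inter> {x. x $ j \<le> pi})" by (auto simp: S_def)
    also have "\<dots> \<in> sets borel"
      by (intro sets.finite_INT sets.Int borel_open borel_closed open_halfspace_component_gt_cart
          closed_halfspace_component_le_cart) auto
    finally have [measurable]: "S \<in> sets borel" .
    have "continuous_on UNIV \<Phi>" unfolding \<Phi>_def by (intro continuous_intros)
    then have [measurable]: "\<Phi> \<in> borel_measurable borel" by (rule borel_measurable_continuous_onI)
    show ?thesis by measurable
  qed
  have "(\<integral>\<^sup>+x. ennreal (indicator S x *\<^sub>R \<Phi> x) \<partial>lborel) = (\<integral>\<^sup>+x. ennreal (\<Phi> x) * indicator S x \<partial>lborel)"
    by (intro nn_integral_cong) (simp add: indicator_def)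
  also have "\<dots> = (\<integral>\<^sup>+y. ennreal (\<Phi> (\<Sum>b\<in>Basis. y b *\<^sub>R b)) * indicator S (\<Sum>b\<in>Basis. y b *\<^sub>R b)
      \<partial>(PiM Basis (\<lambda>_. lborel)))"
    by (subst lborel_eq, rule nn_integral_distr) (use meas in measurable)
  also have "\<dots> = torus_norm Basis B (\<lambda>k. of_bool (lattice_vec k \<in> W))"
    unfolding torus_norm_def \<Phi>_eq ind_eq ..
  also have "\<dots> \<le> ennreal R" using le by (simp add: B_def)
  finally have int: "(LINT x : S | lborel. \<Phi> x) \<le> R"
    unfolding set_lebesgue_integral_def by (intro integral_real_bounded R)
  have "1 \<le> (2 * pi) ^ CARD('d)" using pi_gt3 by (intro one_le_power) simp
  then have "1 / (2 * pi) ^ CARD('d) \<le> 1" by simp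
  then have "1 / (2 * pi) ^ CARD('d) * (LINT x : S | lborel. \<Phi> x) \<le> 1 * R"
    using int R by (intro order.trans[OF mult_left_mono[OF int] mult_right_mono]) auto
  then show ?thesis unfolding lebesgue_constant_def S_def \<Phi>_def Z_def by simp
qed

text \<open>
  Sorting the points of a simplex by the set of vertices with positive barycentric coordinate
  partitions it into at most $2^{d+1}$ pieces, the relative interiors of its faces. Each piece is
  cut out by at most $2(d+1)$ half-spaces, one for a positive coordinate and two for a vanishing
  one, and each face contains a piece or is disjoint from it.
\<close>

lemma torus_norm_simplex_minus_faces:
  fixes C :: "(real ^ 'd) set" and n :: "real ^ 'd"
  assumes C: "\<not> affine_dependent C" and \<G>: "\<And>C'. C' \<in> \<G> \<Longrightarrow> C' \<subseteq> C"
    and bound: "\<And>K. cell Basis (\<lambda>b. n \<bullet> b) (2 * (CARD('d) + 1)) K \<Longrightarrow>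
      torus_norm Basis (int_box Basis (\<lambda>b. n \<bullet> b)) (\<lambda>k. of_bool (k \<in> K)) \<le> ennreal X"
    and X: "0 \<le> X"
  shows "torus_norm Basis (int_box Basis (\<lambda>b. n \<bullet> b))
      (\<lambda>k. of_bool (lattice_vec k \<in> convex hull C - (\<Union>C'\<in>\<G>. convex hull C'))) \<le> ennreal (2 ^ (CARD('d) + 1) * X)"
proof -
  obtain B w r where B: "finite B" "card B \<le> DIM(real ^ 'd) + 1" "C \<subseteq> B" and
    hull: "\<forall>C'\<subseteq>C. convex hull C' =
      {x. (\<forall>b\<in>B. 0 \<le> w b \<bullet> x + r b) \<and> (\<forall>b\<in>B - C'. w b \<bullet> x + (r b :: real) = 0)}"
    using barycentric_coordinates[OF C] by (elim exE conjE)
  define \<beta> where "\<beta> = (\<lambda>b x. w b \<bullet> x + r b)"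
  define box where "box = int_box (Basis :: (real ^ 'd) set) (\<lambda>b. n \<bullet> b)"
  define \<kappa> where "\<kappa> = (\<lambda>S. {k \<in> box. \<forall>b\<in>B. (b \<in> S \<longrightarrow> 0 < \<beta> b (lattice_vec k)) \<and> (b \<notin> S \<longrightarrow> \<beta> b (lattice_vec k) = 0)})"
  define \<S> where "\<S> = {S \<in> Pow C. \<forall>C'\<in>\<G>. \<not> S \<subseteq> C'}"
  have finC: "finite C" using B finite_subset by blast
  have fin: "finite \<S>" using finC by (simp add: \<S>_def)
  have "card \<S> \<le> card (Pow C)" using finC by (intro card_mono) (auto simp: \<S>_def)
  also have "\<dots> = 2 ^ card C" using finC by (simp add: card_Pow)
  also have "\<dots> \<le> 2 ^ (CARD('d) + 1)"
    using card_mono[OF B(1,3)] B(2) by (intro power_increasing) auto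
  finally have card: "card \<S> \<le> 2 ^ (CARD('d) + 1)" .
  have \<kappa>: "cell Basis (\<lambda>b. n \<bullet> b) (2 * (CARD('d) + 1)) (\<kappa> S)" for S
  proof -
    define f where "f = (\<lambda>b. (\<lambda>b'. w b \<bullet> b', r b))"
    have f: "aff Basis (f b) k = \<beta> b (lattice_vec k)" for b k
      by (simp add: aff_def f_def \<beta>_def inner_lattice_vec)
    have "cell Basis (\<lambda>b. n \<bullet> b) 2
      {k \<in> box. (b \<in> S \<longrightarrow> 0 < \<beta> b (lattice_vec k)) \<and> (b \<notin> S \<longrightarrow> \<beta> b (lattice_vec k) = 0)}" for b
    proof (cases "b \<in> S")
      case True
      have "cell Basis (\<lambda>b. n \<bullet> b) 1 {k \<in> box. aff Basis (\<lambda>_. 0, 0) k < aff Basis (f b) k}"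
        unfolding box_def by (rule cell_less) simp
      then have "cell Basis (\<lambda>b. n \<bullet> b) 2 {k \<in> box. aff Basis (\<lambda>_. 0, 0) k < aff Basis (f b) k}"
        by (rule cell_mono) simp
      then show ?thesis using True by (simp add: f aff_const)
    next
      case False
      have "cell Basis (\<lambda>b. n \<bullet> b) (1 + 1) {k \<in> box. aff Basis (\<lambda>_. 0, 0) k \<le> aff Basis (f b) k \<and>
          aff Basis (f b) k \<le> aff Basis (\<lambda>_. 0, 0) k}"
        unfolding box_def by (intro cell_Collect_conj cell_le)
      also have "{k \<in> box. aff Basis (\<lambda>_. 0, 0) k \<le> aff Basis (f b) k \<and> aff Basis (f b) k \<le> aff Basis (\<lambda>_. 0, 0) k}
        = {k \<in> box. (b \<in> S \<longrightarrow> 0 < \<beta> b (lattice_vec k)) \<and> (b \<notin> S \<longrightarrow> \<beta> b (lattice_vec k) = 0)}"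
        using False by (auto simp: f aff_const)
      finally show ?thesis by (simp only: one_add_one)
    qed
    then have "cell Basis (\<lambda>b. n \<bullet> b) (card B * 2) (\<kappa> S)"
      unfolding \<kappa>_def box_def by (intro cell_INT B)
    then show ?thesis by (rule cell_mono) (use B(2) in simp)
  qed
  have split: "of_bool (lattice_vec k \<in> convex hull C - (\<Union>C'\<in>\<G>. convex hull C')) = (\<Sum>S\<in>\<S>. of_bool (k \<in> \<kappa> S) :: complex)"
    if k: "k \<in> box" for k
  proof -
    define x where "x = lattice_vec k"
    define S0 where "S0 = {b \<in> B. 0 < \<beta> b x}"
    have zero_iff: "\<beta> b x = 0 \<longleftrightarrow> b \<notin> S0" if "\<forall>b\<in>B. 0 \<le> \<beta> b x" "b \<in> B" for b
      using that by (force simp: S0_def not_less intro: order.antisym)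
    have S0B: "S0 \<subseteq> B" by (auto simp: S0_def)
    have hull': "x \<in> convex hull C' \<longleftrightarrow> (\<forall>b\<in>B. 0 \<le> \<beta> b x) \<and> S0 \<subseteq> C'" if "C' \<subseteq> C" for C'
    proof -
      have "x \<in> convex hull C' \<longleftrightarrow> (\<forall>b\<in>B. 0 \<le> \<beta> b x) \<and> (\<forall>b\<in>B - C'. \<beta> b x = 0)"
        using hull that unfolding \<beta>_def by auto
      then show ?thesis using zero_iff S0B by blast
    qed
    have mem: "k \<in> \<kappa> S \<longleftrightarrow> (\<forall>b\<in>B. 0 \<le> \<beta> b x) \<and> S0 = S" if "S \<subseteq> C" for S
    proof
      assume "k \<in> \<kappa> S"
      then have *: "\<And>b. b \<in> B \<Longrightarrow> b \<in> S \<Longrightarrow> 0 < \<beta> b x" "\<And>b. b \<in> B \<Longrightarrow> b \<notin> S \<Longrightarrow> \<beta> b x = 0"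
        by (auto simp: \<kappa>_def x_def)
      have "0 \<le> \<beta> b x" if "b \<in> B" for b using *[OF that] by (cases "b \<in> S") auto
      moreover have "S0 = S" using * \<open>S \<subseteq> C\<close> B(3) by (force simp: S0_def)
      ultimately show "(\<forall>b\<in>B. 0 \<le> \<beta> b x) \<and> S0 = S" by blast
    next
      assume *: "(\<forall>b\<in>B. 0 \<le> \<beta> b x) \<and> S0 = S"
      then have "\<And>b. b \<in> B \<Longrightarrow> b \<notin> S \<Longrightarrow> \<beta> b x = 0" using zero_iff by blast
      moreover have "\<And>b. b \<in> S \<Longrightarrow> 0 < \<beta> b x" using * by (auto simp: S0_def)
      ultimately show "k \<in> \<kappa> S" using k by (simp add: \<kappa>_def x_def)
    qed
    define pos where "pos \<longleftrightarrow> (\<forall>b\<in>B. 0 \<le> \<beta> b x)"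
    have "(\<Sum>S\<in>\<S>. of_bool (k \<in> \<kappa> S) :: complex) = (\<Sum>S\<in>\<S>. if S = S0 then of_bool pos else 0)"
      by (intro sum.cong refl) (auto simp: \<S>_def mem pos_def)
    also have "\<dots> = of_bool (pos \<and> S0 \<in> \<S>)" using fin by simp
    also have "pos \<and> S0 \<in> \<S> \<longleftrightarrow> x \<in> convex hull C - (\<Union>C'\<in>\<G>. convex hull C')"
      using hull'[OF order.refl] hull'[OF \<G>] by (auto simp: \<S>_def pos_def)
    finally show ?thesis by (simp add: x_def)
  qed
  have "torus_norm Basis box (\<lambda>k. of_bool (lattice_vec k \<in> convex hull C - (\<Union>C'\<in>\<G>. convex hull C')))
    = torus_norm Basis box (\<lambda>k. \<Sum>S\<in>\<S>. of_bool (k \<in> \<kappa> S))"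
    by (rule torus_norm_cong) (rule split)
  also have "\<dots> \<le> (\<Sum>S\<in>\<S>. torus_norm Basis box (\<lambda>k. of_bool (k \<in> \<kappa> S)))"
    by (rule torus_norm_sum_le) (simp_all add: fin)
  also have "\<dots> \<le> (\<Sum>S\<in>\<S>. ennreal X)"
    unfolding box_def by (intro sum_mono bound \<kappa>)
  also have "\<dots> = ennreal (real (card \<S>) * X)"
    by (simp add: ennreal_mult' ennreal_of_nat_eq_real_of_nat)
  also have "\<dots> \<le> ennreal (2 ^ (CARD('d) + 1) * X)"
  proof (intro ennreal_leI mult_right_mono X)
    show "real (card \<S>) \<le> 2 ^ (CARD('d) + 1)"
      using card by (metis of_nat_le_iff of_nat_numeral of_nat_power)
  qed
  finally show ?thesis by (simp add: box_def)
qed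

text \<open>
  Simplices are added one at a time. A new simplex meets each of the previous ones in a face of its
  own, so it contributes itself minus some of its faces.
\<close>

lemma torus_norm_union_simplices:
  fixes \<T> :: "(real ^ 'd) set set" and n :: "real ^ 'd"
  assumes \<T>: "finite \<T>" "\<And>T. T \<in> \<T> \<Longrightarrow> \<exists>m. m simplex T"
      "\<And>T T'. T \<in> \<T> \<Longrightarrow> T' \<in> \<T> \<Longrightarrow> (T \<inter> T') face_of T"
    and bound: "\<And>K. cell Basis (\<lambda>b. n \<bullet> b) (2 * (CARD('d) + 1)) K \<Longrightarrow>
      torus_norm Basis (int_box Basis (\<lambda>b. n \<bullet> b)) (\<lambda>k. of_bool (k \<in> K)) \<le> ennreal X"
    and X: "0 \<le> X"
  shows "torus_norm Basis (int_box Basis (\<lambda>b. n \<bullet> b)) (\<lambda>k. of_bool (lattice_vec k \<in> \<Union>\<T>))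
    \<le> ennreal (real (card \<T>) * (2 ^ (CARD('d) + 1) * X))"
  using \<T>
proof (induction \<T> rule: finite_induct)
  case empty
  then show ?case by (simp add: torus_norm_def)
next
  case (insert T \<T>)
  obtain C where C: "\<not> affine_dependent C" "T = convex hull C"
    using insert.prems(1)[of T] by (auto simp: simplex_def)
  have "\<exists>C'. C' \<subseteq> C \<and> T \<inter> T' = convex hull C'" if "T' \<in> \<T>" for T'
    using insert.prems(2)[of T T'] that face_of_convex_hull_affine_independent[OF C(1), of "T \<inter> T'"]
    unfolding C(2) by blast
  then have "\<forall>T'\<in>\<T>. \<exists>C'. C' \<subseteq> C \<and> T \<inter> T' = convex hull C'" by blast
  from bchoice[OF this] obtain V where
    V: "\<forall>T'\<in>\<T>. V T' \<subseteq> C \<and> T \<inter> T' = convex hull (V T')" by blast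
  have "T - \<Union>\<T> = T - (\<Union>T'\<in>\<T>. T \<inter> T')" by blast
  also have "(\<Union>T'\<in>\<T>. T \<inter> T') = (\<Union>C'\<in>V ` \<T>. convex hull C')" using V by simp
  finally have diff: "T - \<Union>\<T> = convex hull C - (\<Union>C'\<in>V ` \<T>. convex hull C')"
    unfolding C(2) .
  have "torus_norm Basis (int_box Basis (\<lambda>b. n \<bullet> b)) (\<lambda>k. of_bool (lattice_vec k \<in> \<Union>(insert T \<T>)))
    = torus_norm Basis (int_box Basis (\<lambda>b. n \<bullet> b))
       (\<lambda>k. of_bool (lattice_vec k \<in> T - \<Union>\<T>) + of_bool (lattice_vec k \<in> \<Union>\<T>))"
    by (rule torus_norm_cong) auto
  also have "\<dots> \<le> torus_norm Basis (int_box Basis (\<lambda>b. n \<bullet> b)) (\<lambda>k. of_bool (lattice_vec k \<in> T - \<Union>\<T>))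
      + torus_norm Basis (int_box Basis (\<lambda>b. n \<bullet> b)) (\<lambda>k. of_bool (lattice_vec k \<in> \<Union>\<T>))"
    by (rule torus_norm_add_le) simp
  also have "\<dots> \<le> ennreal (2 ^ (CARD('d) + 1) * X) + ennreal (real (card \<T>) * (2 ^ (CARD('d) + 1) * X))"
  proof (rule add_mono)
    show "torus_norm Basis (int_box Basis (\<lambda>b. n \<bullet> b)) (\<lambda>k. of_bool (lattice_vec k \<in> T - \<Union>\<T>))
        \<le> ennreal (2 ^ (CARD('d) + 1) * X)"
      unfolding diff by (rule torus_norm_simplex_minus_faces[OF C(1) _ bound X]) (use V in blast)
    show "torus_norm Basis (int_box Basis (\<lambda>b. n \<bullet> b)) (\<lambda>k. of_bool (lattice_vec k \<in> \<Union>\<T>))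
        \<le> ennreal (real (card \<T>) * (2 ^ (CARD('d) + 1) * X))"
      using insert.prems by (intro insert.IH) auto
  qed
  also have "\<dots> = ennreal (2 ^ (CARD('d) + 1) * X + real (card \<T>) * (2 ^ (CARD('d) + 1) * X))"
    using X by (intro ennreal_plus[symmetric]) auto
  also have "2 ^ (CARD('d) + 1) * X + real (card \<T>) * (2 ^ (CARD('d) + 1) * X)
      = real (card (insert T \<T>)) * (2 ^ (CARD('d) + 1) * X)"
    using insert.hyps by (simp add: distrib_right)
  finally show ?case .
qed

lemma prod_ln_nonneg:
  fixes n :: "real ^ 'd"
  assumes "\<forall>j. 1 \<le> n $ j"
  shows "0 \<le> (\<Prod>j\<in>UNIV. ln (n $ j + 1))"
proof (intro prod_nonneg ballI ln_ge_zero)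
  fix j
  have "1 \<le> n $ j" using assms by blast
  then show "1 \<le> n $ j + 1" by simp
qed

text \<open>
  The number of simplices enters only through the number of pieces, hence linearly. Both assertions
  of the final theorem are instances of this bound.
\<close>

lemma lebesgue_constant_triangulated:
  "\<exists>C>0. \<forall>(P :: (real ^ 'd) set) \<T> (n :: real ^ 'd).
     (\<forall>j. 1 \<le> n $ j) \<and> P \<subseteq> {x. \<forall>j. 0 \<le> x $ j \<and> x $ j \<le> n $ j} \<and> triangulates \<T> P \<longrightarrow>
     lebesgue_constant P \<le> C * real (card \<T>) * (\<Prod>j\<in>UNIV. ln (n $ j + 1))"
proof -
  obtain C where C: "0 < C" and bound: "\<And>(J :: (real ^ 'd) set) n K. finite J \<Longrightarrow> card J = CARD('d) \<Longrightarrow>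
      \<forall>j\<in>J. 1 \<le> n j \<Longrightarrow> cell J n (2 * (CARD('d) + 1)) K \<Longrightarrow>
      torus_norm J (int_box J n) (\<lambda>k. of_bool (k \<in> K)) \<le> ennreal (C * (\<Prod>j\<in>J. ln (n j + 1)))"
    using torus_norm_cell[of "CARD('d)" "2 * (CARD('d) + 1)"] by blast
  show ?thesis
  proof (intro exI[of _ "2 ^ (CARD('d) + 1) * C"] conjI allI impI)
    show "0 < 2 ^ (CARD('d) + 1) * C" using C by simp
    fix P :: "(real ^ 'd) set" and \<T> and n :: "real ^ 'd"
    assume *: "(\<forall>j. 1 \<le> n $ j) \<and> P \<subseteq> {x. \<forall>j. 0 \<le> x $ j \<and> x $ j \<le> n $ j} \<and> triangulates \<T> P"
    define L where "L = (\<Prod>j\<in>UNIV. ln (n $ j + 1))"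
    have ge1: "\<forall>b\<in>Basis. 1 \<le> n \<bullet> b" using * unfolding all_Basis_vec[of "\<lambda>y. 1 \<le> y"] by blast
    have L: "0 \<le> L" unfolding L_def using * by (intro prod_ln_nonneg) blast
    have LB: "(\<Prod>b\<in>Basis. ln (n \<bullet> b + 1)) = L" unfolding L_def by (rule prod_Basis_vec)
    have tri: "finite \<T>" "\<And>T. T \<in> \<T> \<Longrightarrow> \<exists>m. m simplex T"
      "\<And>T T'. T \<in> \<T> \<Longrightarrow> T' \<in> \<T> \<Longrightarrow> (T \<inter> T') face_of T" "P = \<Union>\<T>"
      using * by (auto simp: triangulates_def triangulation_def)
    have cells: "torus_norm Basis (int_box Basis (\<lambda>b. n \<bullet> b)) (\<lambda>k. of_bool (k \<in> K)) \<le> ennreal (C * L)"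
      if "cell Basis (\<lambda>b. n \<bullet> b) (2 * (CARD('d) + 1)) K" for K
      using bound[OF finite_Basis _ ge1 that] unfolding LB by simp
    have "lebesgue_constant P \<le> real (card \<T>) * (2 ^ (CARD('d) + 1) * (C * L))"
    proof (rule lebesgue_constant_le[of P n])
      show "torus_norm Basis (int_box Basis (\<lambda>b. n \<bullet> b)) (\<lambda>k. of_bool (lattice_vec k \<in> P))
          \<le> ennreal (real (card \<T>) * (2 ^ (CARD('d) + 1) * (C * L)))"
        unfolding tri(4) by (rule torus_norm_union_simplices[OF tri(1-3) cells]) (use C L in auto)
    qed (use * C L in auto)
    then show "lebesgue_constant P \<le> 2 ^ (CARD('d) + 1) * C * real (card \<T>) * (\<Prod>j\<in>UNIV. ln (n $ j + 1))"
      by (simp add: L_def mult_ac)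
  qed
qed

theorem theorem4p1:
  shows "(\<exists>C :: nat \<Rightarrow> real. (\<forall>s. 0 < C s) \<and>
           (\<forall>(P :: (real ^ 'd) set) \<T> (n :: real ^ 'd) s.
              polyhedron P \<and> bounded P \<and>
              (\<forall>j. 1 \<le> n $ j) \<and> P \<subseteq> {x. \<forall>j. 0 \<le> x $ j \<and> x $ j \<le> n $ j} \<and>
              triangulates \<T> P \<and> card \<T> = s \<longrightarrow>
              lebesgue_constant P \<le> C s * (\<Prod>j\<in>UNIV. ln (n $ j + 1)))) \<and>
         (\<exists>(C :: real) (N\<^sub>0 :: nat \<Rightarrow> real). 0 < C \<and>
           (\<forall>(P :: (real ^ 'd) set) \<T> (n :: real ^ 'd) s.
              polyhedron P \<and> bounded P \<and>
              (\<forall>j. 1 \<le> n $ j) \<and> P \<subseteq> {x. \<forall>j. 0 \<le> x $ j \<and> x $ j \<le> n $ j} \<and>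
              triangulates \<T> P \<and> card \<T> = s \<and> (\<forall>j. N\<^sub>0 s \<le> n $ j) \<longrightarrow>
              lebesgue_constant P \<le> C * real s * (\<Prod>j\<in>UNIV. ln (n $ j + 1))))"
proof -
  obtain C where C: "0 < C" and le: "\<And>(P :: (real ^ 'd) set) \<T> (n :: real ^ 'd).
     \<forall>j. 1 \<le> n $ j \<Longrightarrow> P \<subseteq> {x. \<forall>j. 0 \<le> x $ j \<and> x $ j \<le> n $ j} \<Longrightarrow> triangulates \<T> P \<Longrightarrow>
     lebesgue_constant P \<le> C * real (card \<T>) * (\<Prod>j\<in>UNIV. ln (n $ j + 1))"
    using lebesgue_constant_triangulated by blast
  show ?thesis
  proof (intro conjI)
    show "\<exists>C :: nat \<Rightarrow> real. (\<forall>s. 0 < C s) \<and>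
           (\<forall>(P :: (real ^ 'd) set) \<T> (n :: real ^ 'd) s.
              polyhedron P \<and> bounded P \<and>
              (\<forall>j. 1 \<le> n $ j) \<and> P \<subseteq> {x. \<forall>j. 0 \<le> x $ j \<and> x $ j \<le> n $ j} \<and>
              triangulates \<T> P \<and> card \<T> = s \<longrightarrow>
              lebesgue_constant P \<le> C s * (\<Prod>j\<in>UNIV. ln (n $ j + 1)))"
    \<comment> \<open>The successor keeps the constant positive for the empty triangulation.\<close>
    proof (intro exI[of _ "\<lambda>s. C * real (Suc s)"] conjI allI impI)
      show "0 < C * real (Suc s)" for s using C by simp
      fix P :: "(real ^ 'd) set" and \<T> and n :: "real ^ 'd" and s
      assume *: "polyhedron P \<and> bounded P \<and>
              (\<forall>j. 1 \<le> n $ j) \<and> P \<subseteq> {x. \<forall>j. 0 \<le> x $ j \<and> x $ j \<le> n $ j} \<and>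
              triangulates \<T> P \<and> card \<T> = s"
      have "0 \<le> (\<Prod>j\<in>UNIV. ln (n $ j + 1))"
        using * by (intro prod_ln_nonneg) blast
      then have "C * real s * (\<Prod>j\<in>UNIV. ln (n $ j + 1)) \<le> C * real (Suc s) * (\<Prod>j\<in>UNIV. ln (n $ j + 1))"
        using C by (intro mult_right_mono mult_left_mono) auto
      then show "lebesgue_constant P \<le> C * real (Suc s) * (\<Prod>j\<in>UNIV. ln (n $ j + 1))"
        using le[of n P \<T>] * order.trans by blast
    qed
    show "\<exists>(C :: real) (N\<^sub>0 :: nat \<Rightarrow> real). 0 < C \<and>
           (\<forall>(P :: (real ^ 'd) set) \<T> (n :: real ^ 'd) s.
              polyhedron P \<and> bounded P \<and>
              (\<forall>j. 1 \<le> n $ j) \<and> P \<subseteq> {x. \<forall>j. 0 \<le> x $ j \<and> x $ j \<le> n $ j} \<and>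
              triangulates \<T> P \<and> card \<T> = s \<and> (\<forall>j. N\<^sub>0 s \<le> n $ j) \<longrightarrow>
              lebesgue_constant P \<le> C * real s * (\<Prod>j\<in>UNIV. ln (n $ j + 1)))"
    proof (intro exI[of _ C] exI[of _ "\<lambda>_. 0"] conjI allI impI)
    qed (use C le in blast)+
  qed
qed

end
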